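(* Let $\tau\in\mathfrak{T}_n$ be a partial permutation and $\omega=\begin{pmatrix}\tau\\1_n\end{pmatrix}$. Then $\Xi_{\mathfrak{k}}(\omega)=\Phi(\tau)$.
   Context: Work over $\mathbb{C}$; $\mathrm{M}_n$ is the space of $n\times n$ matrices. $\mathscr{P}(n)$ is the set of partitions of $n$; for $\lambda\in\mathscr{P}(n)$, $\mathcal{O}_\lambda\subset\mathrm{M}_n$ is the set of nilpotent matrices with Jordan block sizes the parts of $\lambda$. A partial permutation is an $n\times n$ $0/1$ matrix with at most one $1$ in each row and each column; $\mathfrak{T}_n$ is the set of these. $B\subset\mathrm{GL}_n$ is the group of upper triangular matrices and $\mathfrak{n}\subset\mathrm{M}_n$ the strictly upper triangular matrices. **The map $\Phi$.** $B\times B$ acts on $\mathrm{M}_n$ by $(b_1,b_2)\cdot x=b_1xb_2^{-1}$; the conormal variety is $\mathcal{Y}_{\mathrm{M}_n}=\{(x,y)\in\mathrm{M}_n\times\mathrm{M}_n: xy\in\mathfrak{n},\ yx\in\mathfrak{n}\}$, and its irreducible components are $\mathcal{Y}_\tau=\overline{\{(x,y)\in\mathcal{Y}_{\mathrm{M}_n}:x\in B\tau B\}}$ for $\tau\in\mathfrak{T}_n$. Let $\varphi(x,y)=(xy,yx)$. The generalized Steinberg map $\Phi:\mathfrak{T}_n\to\mathscr{P}(n)\times\mathscr{P}(n)$ is defined by $\Phi(\tau)=(\lambda,\mu)$ where $\overline{(\mathrm{GL}_n\times\mathrm{GL}_n)\cdot\varphi(\mathcal{Y}_\tau)}=\overline{\mathcal{O}_\lambda}\times\overline{\mathcal{O}_\mu}$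 (conjugation in each factor). **The map $\Xi_{\mathfrak{k}}$.** $G=\mathrm{GL}_{2n}$, $\mathfrak{g}=\mathfrak{gl}_{2n}$, $K\cong\mathrm{GL}_n\times\mathrm{GL}_n$ the block diagonal subgroup, $\mathfrak{k}=\mathrm{Lie}(K)$; for $x=\begin{pmatrix}x_1&x_2\\ x_3&x_4\end{pmatrix}$ put $x^\theta=\begin{pmatrix}x_1&0\\0&x_4\end{pmatrix}$. $B_K=B\times B\subset K$, and $P_{\mathrm S}\subset G$ is the stabilizer of $\mathbb{C}^n\oplus\{0\}$. $\mathfrak{X}=K/B_K\times G/P_{\mathrm S}\cong K/B_K\times\mathrm{Gr}_n(\mathbb{C}^{2n})$ is identified with the set of pairs $(\mathfrak{b}',\mathfrak{p}')$ of a Borel subalgebra $\mathfrak{b}'\subset\mathfrak{k}$ and a parabolic subalgebra $\mathfrak{p}'\subset\mathfrak{g}$ conjugate to $\mathrm{Lie}(P_{\mathrm S})$ (the stabilizer of an $n$-dimensional subspace). With $\mathfrak{nil}$ the nilradical, $\mathcal{Y}=\{(\mathfrak{b}',\mathfrak{p}',x)\in\mathfrak{X}\times\mathfrak{g}: x\in\mathfrak{nil}(\mathfrak{p}'),\ x^\theta\in\mathfrak{nil}(\mathfrak{b}')\}$ and $\pi_{\mathfrak{k}}(\mathfrak{b}',\mathfrak{p}',x)=x^\theta$. $(\mathfrak{T}_n^2)'$ is the set of rank $n$ matrices $\omega=\begin{pmatrix}\tau_1\\ \tau_2\end{pmatrix}$ with $\tau_1,\tau_2\in\mathfrak{T}_n$;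 $\mathfrak{Z}_\omega\subset\mathfrak{X}$ is the $K$-orbit of $(B_K,\operatorname{Im}\omega)$ and $T^*_{\mathfrak{Z}_\omega}\mathfrak{X}=\{(\mathfrak{b}',\mathfrak{p}',x)\in\mathcal{Y}:(\mathfrak{b}',\mathfrak{p}')\in\mathfrak{Z}_\omega\}$. $\Xi_{\mathfrak{k}}(\omega)=(\lambda,\mu)\in\mathscr{P}(n)^2$ is the pair with $\overline{\pi_{\mathfrak{k}}(T^*_{\mathfrak{Z}_\omega}\mathfrak{X})}=\overline{\mathcal{O}_\lambda}\times\overline{\mathcal{O}_\mu}$, where $\mathcal{O}_\lambda\times\mathcal{O}_\mu$ denotes the set of block diagonal matrices with upper left block in $\mathcal{O}_\lambda$ and lower right block in $\mathcal{O}_\mu$. *)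

theory Defs
  imports
    Complex_Main
    "HOL-Library.Multiset"
    "Jordan_Normal_Form.Jordan_Normal_Form"
    "Jordan_Normal_Form.Gauss_Jordan_Elimination"
    "Jordan_Normal_Form.DL_Rank"
begin

section \<open>Zariski closure\<close>

inductive_set poly_funs :: "('a \<Rightarrow> complex) set \<Rightarrow> ('a \<Rightarrow> complex) set"
  for X :: "('a \<Rightarrow> complex) set" where
  coord: "f \<in> X \<Longrightarrow> f \<in> poly_funs X"
| const: "(\<lambda>_. c) \<in> poly_funs X"
| add: "f \<in> poly_funs X \<Longrightarrow> g \<in> poly_funs X \<Longrightarrow> (\<lambda>a. f a + g a) \<in> poly_funs X"
| mult: "f \<in> poly_funs X \<Longrightarrow> g \<in> poly_funs X \<Longrightarrow> (\<lambda>a. f a * g a) \<in> poly_funs X"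

text \<open>The Zariski closure of \<open>S\<close> in the affine space \<open>V\<close> with coordinate functions \<open>X\<close>.\<close>

definition zariski_closure :: "('a \<Rightarrow> complex) set \<Rightarrow> 'a set \<Rightarrow> 'a set \<Rightarrow> 'a set" where
  "zariski_closure X V S =
     {v \<in> V. \<forall>f \<in> poly_funs X. (\<forall>s \<in> S. f s = 0) \<longrightarrow> f v = 0}"

definition mat_coords :: "nat \<Rightarrow> (complex mat \<Rightarrow> complex) set" where
  "mat_coords m = {\<lambda>x. x $$ (i, j) | i j. i < m \<and> j < m}"

definition closure1 :: "nat \<Rightarrow> complex mat set \<Rightarrow> complex mat set" where
  "closure1 m = zariski_closure (mat_coords m) (carrier_mat m m)"

definition closure2 :: "nat \<Rightarrow> (complex mat \<times> complex mat) set \<Rightarrow> (complex mat \<times> complex mat) set" where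
  "closure2 m = zariski_closure
     ((\<lambda>f. f \<circ> fst) ` mat_coords m \<union> (\<lambda>f. f \<circ> snd) ` mat_coords m)
     (carrier_mat m m \<times> carrier_mat m m)"

section \<open>Matrices\<close>

definition GL :: "nat \<Rightarrow> complex mat set" where
  "GL m = {g \<in> carrier_mat m m. invertible_mat g}"

text \<open>\<^const>\<open>mat_inverse\<close> is option-valued; \<open>Ad g x\<close> is only meaningful for invertible \<open>g\<close>.\<close>

definition Ad :: "complex mat \<Rightarrow> complex mat \<Rightarrow> complex mat" where
  "Ad g x = g * x * the (mat_inverse g)"

definition upper_triangular_mats :: "nat \<Rightarrow> complex mat set" where
  "upper_triangular_mats n = {x \<in> carrier_mat n n. upper_triangular x}"

definition strictly_upper_mats :: "nat \<Rightarrow> complex mat set" where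
  "strictly_upper_mats n = {x \<in> carrier_mat n n. \<forall>i < n. \<forall>j \<le> i. x $$ (i, j) = 0}"

definition Borel :: "nat \<Rightarrow> complex mat set" where
  "Borel n = GL n \<inter> upper_triangular_mats n"

definition nilpotent_mat :: "complex mat \<Rightarrow> bool" where
  "nilpotent_mat x \<longleftrightarrow> (\<exists>k. x ^\<^sub>m k = 0\<^sub>m (dim_row x) (dim_row x))"

definition partitions :: "nat \<Rightarrow> nat multiset set" where
  "partitions n = {l. 0 \<notin># l \<and> sum_mset l = n}"

definition nilp_orbit :: "nat \<Rightarrow> nat multiset \<Rightarrow> complex mat set" where
  "nilp_orbit n l = {x \<in> carrier_mat n n. nilpotent_mat x \<and>
     (\<exists>n_as. jordan_nf x n_as \<and> mset (map fst n_as) = l)}"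

definition partial_perms :: "nat \<Rightarrow> complex mat set" where
  "partial_perms n = {t \<in> carrier_mat n n.
     (\<forall>i < n. \<forall>j < n. t $$ (i, j) \<in> {0, 1}) \<and>
     (\<forall>i < n. card {j. j < n \<and> t $$ (i, j) = 1} \<le> 1) \<and>
     (\<forall>j < n. card {i. i < n \<and> t $$ (i, j) = 1} \<le> 1)}"

section \<open>The generalized Steinberg map\<close>

definition conormal_mat :: "nat \<Rightarrow> (complex mat \<times> complex mat) set" where
  "conormal_mat n = {(x, y). x \<in> carrier_mat n n \<and> y \<in> carrier_mat n n \<and>
     x * y \<in> strictly_upper_mats n \<and> y * x \<in> strictly_upper_mats n}"

definition conormal_comp :: "nat \<Rightarrow> complex mat \<Rightarrow> (complex mat \<times> complex mat) set" where
  "conormal_comp n t = closure2 n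
     {(x, y) \<in> conormal_mat n. x \<in> {b1 * t * b2 | b1 b2. b1 \<in> Borel n \<and> b2 \<in> Borel n}}"

definition GLxGL_saturation ::
  "nat \<Rightarrow> (complex mat \<times> complex mat) set \<Rightarrow> (complex mat \<times> complex mat) set" where
  "GLxGL_saturation n S = {(Ad g x, Ad h y) | g h x y. g \<in> GL n \<and> h \<in> GL n \<and> (x, y) \<in> S}"

definition Phi :: "nat \<Rightarrow> complex mat \<Rightarrow> nat multiset \<times> nat multiset" where
  "Phi n t = (THE (l, m). l \<in> partitions n \<and> m \<in> partitions n \<and>
     closure2 n (GLxGL_saturation n ((\<lambda>(x, y). (x * y, y * x)) ` conormal_comp n t))
       = closure1 n (nilp_orbit n l) \<times> closure1 n (nilp_orbit n m))"

section \<open>Lie subalgebras of matrix algebras\<close>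

definition bracket :: "complex mat \<Rightarrow> complex mat \<Rightarrow> complex mat" where
  "bracket x y = x * y - y * x"

definition mat_subspace :: "nat \<Rightarrow> complex mat set \<Rightarrow> bool" where
  "mat_subspace m S \<longleftrightarrow> S \<subseteq> carrier_mat m m \<and> 0\<^sub>m m m \<in> S \<and>
     (\<forall>x \<in> S. \<forall>y \<in> S. x + y \<in> S) \<and> (\<forall>c. \<forall>x \<in> S. c \<cdot>\<^sub>m x \<in> S)"

definition lie_subalgebra :: "nat \<Rightarrow> complex mat set \<Rightarrow> bool" where
  "lie_subalgebra m q \<longleftrightarrow> mat_subspace m q \<and> (\<forall>x \<in> q. \<forall>y \<in> q. bracket x y \<in> q)"

definition lie_ideal :: "nat \<Rightarrow> complex mat set \<Rightarrow> complex mat set \<Rightarrow> bool" where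
  "lie_ideal m I q \<longleftrightarrow> mat_subspace m I \<and> I \<subseteq> q \<and> (\<forall>x \<in> q. \<forall>y \<in> I. bracket x y \<in> I)"

definition derived_algebra :: "nat \<Rightarrow> complex mat set \<Rightarrow> complex mat set" where
  "derived_algebra m q = \<Inter> {S. mat_subspace m S \<and> (\<forall>x \<in> q. \<forall>y \<in> q. bracket x y \<in> S)}"

definition lie_solvable :: "nat \<Rightarrow> complex mat set \<Rightarrow> bool" where
  "lie_solvable m q \<longleftrightarrow> (\<exists>k. (derived_algebra m ^^ k) q = {0\<^sub>m m m})"

definition borel_subalgebra :: "nat \<Rightarrow> complex mat set \<Rightarrow> complex mat set \<Rightarrow> bool" where
  "borel_subalgebra m q b \<longleftrightarrow> lie_subalgebra m b \<and> lie_solvable m b \<and> b \<subseteq> q \<and>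
     (\<forall>s. lie_subalgebra m s \<and> lie_solvable m s \<and> b \<subseteq> s \<and> s \<subseteq> q \<longrightarrow> s = b)"

text \<open>
  The nilradical of a Borel or parabolic subalgebra \<open>q\<close> of a reductive matrix Lie algebra is the
  Lie algebra of the unipotent radical: the largest ideal of \<open>q\<close> consisting of nilpotent matrices.
  (The largest ideal of \<open>q\<close> that is nilpotent as an abstract Lie algebra would also contain
  the scalar matrices.)
\<close>

definition nilradical :: "nat \<Rightarrow> complex mat set \<Rightarrow> complex mat set" where
  "nilradical m q = \<Union> {I. lie_ideal m I q \<and> (\<forall>x \<in> I. nilpotent_mat x)}"

section \<open>The symmetric pair and the map to pairs of partitions\<close>

definition block_diag :: "complex mat \<Rightarrow> complex mat \<Rightarrow> complex mat" where
  "block_diag x y =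
     four_block_mat x (0\<^sub>m (dim_row x) (dim_col y)) (0\<^sub>m (dim_row y) (dim_col x)) y"

definition block_diags :: "complex mat set \<Rightarrow> complex mat set \<Rightarrow> complex mat set" where
  "block_diags S T = {block_diag x y | x y. x \<in> S \<and> y \<in> T}"

definition K_group :: "nat \<Rightarrow> complex mat set" where
  "K_group n = block_diags (GL n) (GL n)"

definition K_lie :: "nat \<Rightarrow> complex mat set" where
  "K_lie n = block_diags (carrier_mat n n) (carrier_mat n n)"

definition BK_lie :: "nat \<Rightarrow> complex mat set" where
  "BK_lie n = block_diags (upper_triangular_mats n) (upper_triangular_mats n)"

definition theta_part :: "nat \<Rightarrow> complex mat \<Rightarrow> complex mat" where
  "theta_part n x = (case split_block x n n of (x1, x2, x3, x4) \<Rightarrow> block_diag x1 x4)"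

definition stabilizer_algebra :: "nat \<Rightarrow> complex vec set \<Rightarrow> complex mat set" where
  "stabilizer_algebra m W = {x \<in> carrier_mat m m. \<forall>w \<in> W. x *\<^sub>v w \<in> W}"

definition PS_lie :: "nat \<Rightarrow> complex mat set" where
  "PS_lie n = stabilizer_algebra (n + n) {v @\<^sub>v 0\<^sub>v n | v. v \<in> carrier_vec n}"

definition double_flag_variety :: "nat \<Rightarrow> (complex mat set \<times> complex mat set) set" where
  "double_flag_variety n = {(b, p). borel_subalgebra (n + n) (K_lie n) b \<and>
     (\<exists>g \<in> GL (n + n). p = Ad g ` PS_lie n)}"

definition conormal_flag ::
  "nat \<Rightarrow> (complex mat set \<times> complex mat set \<times> complex mat) set" where
  "conormal_flag n = {(b, p, x). (b, p) \<in> double_flag_variety n \<and> x \<in> carrier_mat (n + n) (n + n) \<and>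
     x \<in> nilradical (n + n) p \<and> theta_part n x \<in> nilradical (n + n) b}"

definition mat_image :: "complex mat \<Rightarrow> complex vec set" where
  "mat_image w = {w *\<^sub>v v | v. v \<in> carrier_vec (dim_col w)}"

text \<open>
  The \<open>K\<close>-orbit of \<open>(B\<^sub>K, Im w)\<close>: a subspace \<open>W\<close> in the Grassmannian corresponds to its stabilizer
  subalgebra, and the group acts on pairs of subalgebras by conjugation.
\<close>

definition flag_orbit :: "nat \<Rightarrow> complex mat \<Rightarrow> (complex mat set \<times> complex mat set) set" where
  "flag_orbit n w =
     {(Ad k ` BK_lie n, Ad k ` stabilizer_algebra (n + n) (mat_image w)) | k. k \<in> K_group n}"

definition conormal_bundle ::
  "nat \<Rightarrow> complex mat \<Rightarrow> (complex mat set \<times> complex mat set \<times> complex mat) set" where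
  "conormal_bundle n w = {(b, p, x) \<in> conormal_flag n. (b, p) \<in> flag_orbit n w}"

definition partial_perm_pairs :: "nat \<Rightarrow> complex mat set" where
  "partial_perm_pairs n = {t1 @\<^sub>r t2 | t1 t2. t1 \<in> partial_perms n \<and> t2 \<in> partial_perms n \<and>
     vec_space.rank (n + n) (t1 @\<^sub>r t2) = n}"

text \<open>The intended domain of \<open>Xi_k n\<close> is \<^const>\<open>partial_perm_pairs\<close>.\<close>

definition Xi_k :: "nat \<Rightarrow> complex mat \<Rightarrow> nat multiset \<times> nat multiset" where
  "Xi_k n w = (THE (l, m). l \<in> partitions n \<and> m \<in> partitions n \<and>
     closure1 (n + n) ((\<lambda>(b, p, x). theta_part n x) ` conormal_bundle n w)
       = block_diags (closure1 n (nilp_orbit n l)) (closure1 n (nilp_orbit n m)))"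

lemma one_mat_partial_perm: "1\<^sub>m n \<in> partial_perms n"
proof -
  have "{j. j < n \<and> (1\<^sub>m n :: complex mat) $$ (i, j) = 1} = {i}"
    and "{j. j < n \<and> (1\<^sub>m n :: complex mat) $$ (j, i) = 1} = {i}" if "i < n" for i
    using that by (auto split: if_splits)
  then show ?thesis by (auto simp: partial_perms_def)
qed

lemma append_one_in_partial_perm_pairs:
  assumes t: "t \<in> partial_perms n"
  shows "t @\<^sub>r 1\<^sub>m n \<in> partial_perm_pairs n"
proof -
  let ?w = "t @\<^sub>r 1\<^sub>m n"
  interpret vec_space "TYPE(complex)" "n + n" .
  have tc: "t \<in> carrier_mat n n" using t by (simp add: partial_perms_def)
  have wc: "?w \<in> carrier_mat (n + n) n" using tc by auto
  have ent: "?w $$ (n + i, j) = (if i = j then 1 else 0)" if "i < n" "j < n" for i j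
    using that tc by (auto simp: append_rows_def)
  have dist: "distinct (cols ?w)"
  proof (unfold distinct_conv_nth, intro allI impI)
    fix i j assume i: "i < length (cols ?w)" and j: "j < length (cols ?w)" and ij: "i \<noteq> j"
    have i': "i < n" and j': "j < n" using i j wc by auto
    have "col ?w i $ (n + i) = 1" "col ?w j $ (n + i) = 0"
      using i' j' ij wc ent by auto
    then have "col ?w i \<noteq> col ?w j" by auto
    then show "cols ?w ! i \<noteq> cols ?w ! j" using i' j' wc by simp
  qed
  have "lin_indpt (set (cols ?w))"
  proof
    assume "lin_dep (set (cols ?w))"
    from lin_depE[OF wc this dist] obtain v where
      v: "v \<in> carrier_vec n" "v \<noteq> 0\<^sub>v n" "?w *\<^sub>v v = 0\<^sub>v (n + n)" by blast
    have "?w *\<^sub>v v = (t *\<^sub>v v) @\<^sub>v (1\<^sub>m n *\<^sub>v v)"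
      by (rule mat_mult_append[OF tc _ v(1)]) auto
    moreover have "(0\<^sub>v (n + n) :: complex vec) = 0\<^sub>v n @\<^sub>v 0\<^sub>v n" by auto
    ultimately have "(t *\<^sub>v v) @\<^sub>v v = 0\<^sub>v n @\<^sub>v 0\<^sub>v n" using v by simp
    moreover have "t *\<^sub>v v \<in> carrier_vec n" using tc v by auto
    ultimately have "v = 0\<^sub>v n" using append_vec_eq by (metis zero_carrier_vec)
    then show False using v by simp
  qed
  from lin_indpt_full_rank[OF wc dist this] have "rank ?w = n" .
  then show ?thesis
    unfolding partial_perm_pairs_def using t one_mat_partial_perm by blast
qed

end

theory Submission
  imports Defs
begin

text \<open>
  Both maps read off a pair of partitions from the closure of a set of pairs of nilpotent matrices,
  and both sets can be computed from the fibre over \<open>\<tau>\<close> of the conormal variety, the linear space of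
  all \<open>a\<close> with \<open>\<tau> a\<close> and \<open>a \<tau>\<close> strictly upper triangular.
  
  On the side of \<open>\<Phi>\<close>, an element of the orbit \<open>B \<tau> B\<close> moves back to \<open>\<tau>\<close>, and this changes \<open>x y\<close> and
  \<open>y x\<close> only by conjugation. So the saturation of the image of the open part of the component is
  \<open>S = {(g (\<tau> a) g\<^sup>-\<^sup>1, h (a \<tau>) h\<^sup>-\<^sup>1)}\<close>, and passing to the closure of the component before
  multiplying and conjugating does not change the closure of the result
  (\<open>closure_saturation_conormal_comp\<close>).
  
  On the side of \<open>\<Xi>\<close>, the image of \<open>\<omega>\<close> is the graph of \<open>\<tau>\<close>, namely \<open>W = {(\<tau> v, v)}\<close>. The nilradical
  of its stabilizer consists of the matrices \<open>x\<close> with \<open>x V \<subseteq> W\<close> and \<open>x W = 0\<close>, that is, of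
  the matrices with rows of blocks \<open>(\<tau> a, - \<tau> a \<tau>)\<close> and \<open>(a, - a \<tau>)\<close>. The diagonal part of such a
  matrix is \<open>(\<tau> a, - a \<tau>)\<close>, and it lies in the nilradical of the standard Borel subalgebra exactly
  when \<open>a\<close> is in the fibre over \<open>\<tau>\<close>. After conjugation by \<open>K\<close> the image of the conormal bundle is
  therefore \<open>{(u, - v) | (u, v) \<in> S}\<close> (\<open>theta_image_conormal_bundle\<close>).
  
  The two sets differ by the sign of the second component. This sign is invisible to the partitions,
  because the negative of a nilpotent matrix has the same Jordan block sizes
  (\<open>nilp_orbit_uminus\<close>). Hence for every pair \<open>(\<lambda>, \<mu>)\<close> the condition that defines \<open>\<Phi>(\<tau>)\<close> holds if
  and only if the one that defines \<open>\<Xi>(\<omega>)\<close> does, and the two descriptions pick the same pair.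
  
  What remains is to determine the nilradicals that occur, and to see that the subalgebras in the
  \<open>K\<close>-orbit belong to the double flag variety at all, which includes that the block diagonal
  upper triangular matrices form a Borel subalgebra of the block diagonal ones. The nilradicals and
  the Borel property are obtained for algebras of matrices cut out by a pattern of zero entries (\<open>nilradical_pattern\<close>, \<open>borel_subalgebra_pattern\<close>).
\<close>

section \<open>Conjugation by invertible matrices\<close>

abbreviation minv :: "complex mat \<Rightarrow> complex mat" where
  "minv g \<equiv> the (mat_inverse g)"

lemma GL_carrier: "g \<in> GL m \<Longrightarrow> g \<in> carrier_mat m m"
  by (simp add: GL_def)

lemma GL_I:
  assumes "g \<in> carrier_mat m m" "h \<in> carrier_mat m m" "g * h = 1\<^sub>m m" "h * g = 1\<^sub>m m"
  shows "g \<in> GL m"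
  using assms unfolding GL_def invertible_mat_def inverts_mat_def by auto

lemma minv_props:
  assumes g: "g \<in> GL m"
  shows "minv g \<in> carrier_mat m m" "g * minv g = 1\<^sub>m m" "minv g * g = 1\<^sub>m m"
proof -
  have gc: "g \<in> carrier_mat m m" using g by (rule GL_carrier)
  from g obtain B where B: "g * B = 1\<^sub>m m" "B * g = 1\<^sub>m (dim_row B)"
    unfolding GL_def invertible_mat_def inverts_mat_def by auto
  have dc: "dim_col B = m" using B(1) by (metis index_mult_mat(3) index_one_mat(3))
  have dr: "dim_row B = m" using B(2) gc
    by (metis carrier_matD(2) index_mult_mat(3) index_one_mat(3))
  have Bc: "B \<in> carrier_mat m m" using dc dr by auto
  have "g \<in> Units (ring_mat TYPE(complex) m undefined)"
    unfolding Units_def ring_mat_def using gc Bc B dr by auto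
  then have "mat_inverse g \<noteq> None" using mat_inverse(1)[OF gc, of undefined] by blast
  then obtain C where C: "mat_inverse g = Some C" by blast
  from mat_inverse(2)[OF gc this] C
  show "minv g \<in> carrier_mat m m" "g * minv g = 1\<^sub>m m" "minv g * g = 1\<^sub>m m" by auto
qed

lemma minv_GL: "g \<in> GL m \<Longrightarrow> minv g \<in> GL m"
  using minv_props GL_carrier GL_I by metis

lemma minv_unique:
  assumes g: "g \<in> carrier_mat m m" and h: "h \<in> carrier_mat m m"
    and gh: "g * h = 1\<^sub>m m" and hg: "h * g = 1\<^sub>m m"
  shows "minv g = h"
proof -
  have G: "g \<in> GL m" using assms by (rule GL_I)
  note p = minv_props[OF G]
  have "minv g = minv g * (g * h)" using p gh by simp
  also have "\<dots> = (minv g * g) * h" using assoc_mult_mat[OF p(1) g h] by simp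
  finally show ?thesis using p h by simp
qed

lemma minv_minv: "g \<in> GL m \<Longrightarrow> minv (minv g) = g"
  using minv_unique minv_props GL_carrier by metis

lemma mult_cancel_mid:
  fixes a b c d :: "complex mat"
  assumes "a \<in> carrier_mat m m" "b \<in> carrier_mat m m" "c \<in> carrier_mat m m" "d \<in> carrier_mat m m"
    and "b * c = 1\<^sub>m m"
  shows "(a * b) * (c * d) = a * d"
proof -
  have "(a * b) * (c * d) = a * (b * c) * d"
    using assms(1-4) by (simp add: assoc_mult_mat[of _ m m _ m _ m])
  then show ?thesis using assms by simp
qed

lemma GL_mult:
  assumes g: "g \<in> GL m" and h: "h \<in> GL m"
  shows "g * h \<in> GL m" "minv (g * h) = minv h * minv g"
proof -
  note c = GL_carrier[OF g] GL_carrier[OF h] minv_props[OF g] minv_props[OF h]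
  have 1: "(g * h) * (minv h * minv g) = 1\<^sub>m m"
    using mult_cancel_mid[OF c(1,2) c(6) c(3)] c by simp
  have 2: "(minv h * minv g) * (g * h) = 1\<^sub>m m"
    using mult_cancel_mid[OF c(6) c(3) c(1,2)] c by simp
  have cc: "g * h \<in> carrier_mat m m" "minv h * minv g \<in> carrier_mat m m" using c by auto
  show "g * h \<in> GL m" using GL_I[OF cc 1 2] .
  show "minv (g * h) = minv h * minv g" using minv_unique[OF cc 1 2] .
qed

lemma mat_subspaceD:
  assumes "mat_subspace m S"
  shows "S \<subseteq> carrier_mat m m" "0\<^sub>m m m \<in> S"
    "\<And>x y. x \<in> S \<Longrightarrow> y \<in> S \<Longrightarrow> x + y \<in> S" "\<And>c x. x \<in> S \<Longrightarrow> c \<cdot>\<^sub>m x \<in> S"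
  using assms by (simp_all add: mat_subspace_def)

lemma mat_subspaceI:
  assumes "S \<subseteq> carrier_mat m m" "0\<^sub>m m m \<in> S"
    "\<And>x y. x \<in> S \<Longrightarrow> y \<in> S \<Longrightarrow> x + y \<in> S" "\<And>c x. x \<in> S \<Longrightarrow> c \<cdot>\<^sub>m x \<in> S"
  shows "mat_subspace m S"
  using assms by (simp add: mat_subspace_def)

context
  fixes g :: "complex mat" and m :: nat
  assumes g: "g \<in> GL m"
begin

lemma Ad_carrier [simp]: "x \<in> carrier_mat m m \<Longrightarrow> Ad g x \<in> carrier_mat m m"
  unfolding Ad_def using GL_carrier[OF g] minv_props[OF g] by auto

lemma Ad_mult:
  assumes "x \<in> carrier_mat m m" "y \<in> carrier_mat m m"
  shows "Ad g (x * y) = Ad g x * Ad g y"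
proof -
  note c = GL_carrier[OF g] minv_props[OF g]
  have "Ad g x * Ad g y = (g * x * minv g) * (g * (y * minv g))"
    unfolding Ad_def using c assms by (simp add: assoc_mult_mat[of _ m m _ m _ m])
  also have "\<dots> = (g * x) * (y * minv g)"
    using mult_cancel_mid[of "g * x" m "minv g" g "y * minv g"] c assms by simp
  also have "\<dots> = Ad g (x * y)"
    unfolding Ad_def using c assms by (simp add: assoc_mult_mat[of _ m m _ m _ m])
  finally show ?thesis by simp
qed

lemma Ad_add:
  assumes "x \<in> carrier_mat m m" "y \<in> carrier_mat m m"
  shows "Ad g (x + y) = Ad g x + Ad g y"
  unfolding Ad_def using GL_carrier[OF g] minv_props[OF g] assms
  by (simp add: mult_add_distrib_mat[of _ m m] add_mult_distrib_mat[of _ m m])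

lemma Ad_minus:
  assumes "x \<in> carrier_mat m m" "y \<in> carrier_mat m m"
  shows "Ad g (x - y) = Ad g x - Ad g y"
  unfolding Ad_def using GL_carrier[OF g] minv_props[OF g] assms
  by (simp add: mult_minus_distrib_mat[of _ m m] minus_mult_distrib_mat[of _ m m])

lemma Ad_smult:
  assumes "x \<in> carrier_mat m m"
  shows "Ad g (c \<cdot>\<^sub>m x) = c \<cdot>\<^sub>m Ad g x"
  unfolding Ad_def using GL_carrier[OF g] minv_props[OF g] assms
  by (simp add: mult_smult_distrib[of _ m m] mult_smult_assoc_mat[of _ m m])

lemma Ad_uminus:
  assumes "x \<in> carrier_mat m m"
  shows "Ad g (- x) = - Ad g x"
  unfolding Ad_def using GL_carrier[OF g] minv_props[OF g] assms
  by simp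

lemma Ad_zero [simp]: "Ad g (0\<^sub>m m m) = 0\<^sub>m m m"
  unfolding Ad_def using GL_carrier[OF g] minv_props[OF g] by simp

lemma Ad_one [simp]: "Ad g (1\<^sub>m m) = 1\<^sub>m m"
  unfolding Ad_def using GL_carrier[OF g] minv_props[OF g] by simp

lemma Ad_bracket:
  assumes "x \<in> carrier_mat m m" "y \<in> carrier_mat m m"
  shows "Ad g (bracket x y) = bracket (Ad g x) (Ad g y)"
  unfolding bracket_def using assms by (simp add: Ad_minus Ad_mult)

lemma Ad_pow:
  assumes x: "x \<in> carrier_mat m m"
  shows "Ad g (x ^\<^sub>m k) = (Ad g x) ^\<^sub>m k"
proof (induction k)
  case 0
  have "dim_row (Ad g x) = m" "dim_row x = m"
    using carrier_matD(1)[OF Ad_carrier[OF x]] carrier_matD(1)[OF x] by auto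
  then show ?case by simp
next
  case (Suc k)
  have "x ^\<^sub>m k \<in> carrier_mat m m" using x by simp
  then show ?case using Ad_mult[of "x ^\<^sub>m k" x] x Suc by simp
qed

lemma Ad_nilpotent:
  assumes x: "x \<in> carrier_mat m m" and "nilpotent_mat x"
  shows "nilpotent_mat (Ad g x)"
proof -
  from assms obtain k where "x ^\<^sub>m k = 0\<^sub>m m m" unfolding nilpotent_mat_def by auto
  then have "(Ad g x) ^\<^sub>m k = 0\<^sub>m m m" using Ad_pow[OF x, of k] by simp
  then show ?thesis using carrier_matD(1)[OF Ad_carrier[OF x]] unfolding nilpotent_mat_def by auto
qed

lemma Ad_mult_GL:
  assumes "h \<in> GL m" "x \<in> carrier_mat m m"
  shows "Ad (g * h) x = Ad g (Ad h x)"
proof -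
  note c = GL_carrier[OF g] minv_props[OF g] GL_carrier[OF assms(1)] minv_props[OF assms(1)] assms(2)
  show ?thesis unfolding Ad_def GL_mult(2)[OF g assms(1)]
    using c by (simp add: assoc_mult_mat[of _ m m _ m _ m])
qed

lemma Ad_image_carrier: "S \<subseteq> carrier_mat m m \<Longrightarrow> Ad g ` S \<subseteq> carrier_mat m m"
  by auto

lemma mat_subspace_Ad:
  assumes S: "mat_subspace m S"
  shows "mat_subspace m (Ad g ` S)"
proof (rule mat_subspaceI)
  note D = mat_subspaceD[OF S]
  have c: "x \<in> carrier_mat m m" if "x \<in> S" for x using D(1) that by (rule subsetD)
  show "Ad g ` S \<subseteq> carrier_mat m m" using D(1) by (rule Ad_image_carrier)
  show "0\<^sub>m m m \<in> Ad g ` S" using image_eqI[where f = "Ad g", OF Ad_zero[symmetric] D(2)] .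
  show "u + v \<in> Ad g ` S" if "u \<in> Ad g ` S" "v \<in> Ad g ` S" for u v
  proof -
    from that obtain x y where x: "x \<in> S" "u = Ad g x" and y: "y \<in> S" "v = Ad g y" by blast
    show ?thesis unfolding x(2) y(2)
      using image_eqI[where f = "Ad g", OF Ad_add[OF c[OF x(1)] c[OF y(1)], symmetric] D(3)[OF x(1) y(1)]] .
  qed
  show "k \<cdot>\<^sub>m u \<in> Ad g ` S" if "u \<in> Ad g ` S" for k u
  proof -
    from that obtain x where x: "x \<in> S" "u = Ad g x" by blast
    show ?thesis unfolding x(2)
      using image_eqI[where f = "Ad g", OF Ad_smult[OF c[OF x(1)], symmetric] D(4)[OF x(1)]] .
  qed
qed

lemma bracket_Ad_image:
  assumes "\<forall>x\<in>S. \<forall>y\<in>T. bracket x y \<in> U" "S \<subseteq> carrier_mat m m" "T \<subseteq> carrier_mat m m"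
  shows "\<forall>x\<in>Ad g ` S. \<forall>y\<in>Ad g ` T. bracket x y \<in> Ad g ` U"
proof -
  have "bracket (Ad g x) (Ad g y) \<in> Ad g ` U" if "x \<in> S" "y \<in> T" for x y
  proof -
    have "x \<in> carrier_mat m m" "y \<in> carrier_mat m m" "bracket x y \<in> U" using assms that by auto
    from image_eqI[where f = "Ad g", OF Ad_bracket[OF this(1,2), symmetric] this(3)] show ?thesis .
  qed
  then show ?thesis by blast
qed

lemma lie_subalgebra_Ad:
  assumes "lie_subalgebra m q"
  shows "lie_subalgebra m (Ad g ` q)"
proof -
  have q: "mat_subspace m q" "\<forall>x\<in>q. \<forall>y\<in>q. bracket x y \<in> q"
    using assms unfolding lie_subalgebra_def by auto
  note c = mat_subspaceD(1)[OF q(1)]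
  show ?thesis unfolding lie_subalgebra_def
    using mat_subspace_Ad[OF q(1)] bracket_Ad_image[OF q(2) c c] by (rule conjI)
qed

lemma lie_ideal_Ad:
  assumes "lie_ideal m I q" "q \<subseteq> carrier_mat m m"
  shows "lie_ideal m (Ad g ` I) (Ad g ` q)"
proof -
  have I: "mat_subspace m I" "I \<subseteq> q" "\<forall>x\<in>q. \<forall>y\<in>I. bracket x y \<in> I"
    using assms(1) unfolding lie_ideal_def by auto
  have c: "I \<subseteq> carrier_mat m m" using I(2) assms(2) by (rule subset_trans)
  show ?thesis unfolding lie_ideal_def
    by (intro conjI mat_subspace_Ad[OF I(1)] image_mono[OF I(2)] bracket_Ad_image[OF I(3) assms(2) c])
qed

end

lemma Ad_one_left: "x \<in> carrier_mat m m \<Longrightarrow> Ad (1\<^sub>m m) x = x"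
  using minv_unique[of "1\<^sub>m m" m "1\<^sub>m m"] unfolding Ad_def by simp

lemma Ad_minv1: "g \<in> GL m \<Longrightarrow> x \<in> carrier_mat m m \<Longrightarrow> Ad g (Ad (minv g) x) = x"
  using Ad_mult_GL[OF _ minv_GL, of g m g x] minv_props[of g m] Ad_one_left[of x] by simp

lemma Ad_image_minv:
  assumes g: "g \<in> GL m" and "S \<subseteq> carrier_mat m m"
  shows "Ad (minv g) ` Ad g ` S = S" "Ad g ` Ad (minv g) ` S = S"
proof -
  have Ad_minv2: "Ad (minv g) (Ad g x) = x" if "x \<in> carrier_mat m m" for x
    using Ad_mult_GL[OF minv_GL[OF g] g that] minv_props[OF g] Ad_one_left[OF that] by simp
  have "Ad (minv g) ` Ad g ` S = (\<lambda>x. x) ` S"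
    unfolding image_image by (rule image_cong) (use Ad_minv2 assms in auto)
  then show "Ad (minv g) ` Ad g ` S = S" by simp
  have "Ad g ` Ad (minv g) ` S = (\<lambda>x. x) ` S"
    unfolding image_image by (rule image_cong) (use Ad_minv1 assms in auto)
  then show "Ad g ` Ad (minv g) ` S = S" by simp
qed

text \<open>
  Stated as an inclusion for arbitrary \<open>g\<close> because the equality below is this inclusion for \<open>g\<close> and
  for its inverse.
\<close>

lemma nilradical_Ad_le:
  assumes g: "g \<in> GL m" and q: "q \<subseteq> carrier_mat m m"
  shows "Ad g ` nilradical m q \<subseteq> nilradical m (Ad g ` q)"
proof
  fix y assume "y \<in> Ad g ` nilradical m q"
  then obtain x I where I: "lie_ideal m I q" "\<forall>x\<in>I. nilpotent_mat x" "x \<in> I" "y = Ad g x"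
    unfolding nilradical_def by blast
  have "\<forall>x\<in>Ad g ` I. nilpotent_mat x"
    using I q Ad_nilpotent[OF g] unfolding lie_ideal_def by blast
  then show "y \<in> nilradical m (Ad g ` q)"
    using I lie_ideal_Ad[OF g I(1) q] unfolding nilradical_def by blast
qed

lemma nilradical_carrier: "q \<subseteq> carrier_mat m m \<Longrightarrow> nilradical m q \<subseteq> carrier_mat m m"
  unfolding nilradical_def lie_ideal_def by blast

lemma nilradical_Ad:
  assumes g: "g \<in> GL m" and q: "q \<subseteq> carrier_mat m m"
  shows "nilradical m (Ad g ` q) = Ad g ` nilradical m q"
proof
  have "Ad (minv g) ` nilradical m (Ad g ` q) \<subseteq> nilradical m q"
    using nilradical_Ad_le[OF minv_GL[OF g] Ad_image_carrier[OF g q]] Ad_image_minv[OF g q] by simp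
  then have "Ad g ` Ad (minv g) ` nilradical m (Ad g ` q) \<subseteq> Ad g ` nilradical m q" by blast
  then show "nilradical m (Ad g ` q) \<subseteq> Ad g ` nilradical m q"
    using Ad_image_minv(2)[OF g nilradical_carrier[OF Ad_image_carrier[OF g q]]] by simp
qed (rule nilradical_Ad_le[OF assms])

section \<open>Derived algebras and conjugates of Borel subalgebras\<close>

lemma mat_subspace_carrier: "mat_subspace m (carrier_mat m m)"
  by (rule mat_subspaceI) auto

lemma bracket_carrier:
  "x \<in> carrier_mat m m \<Longrightarrow> y \<in> carrier_mat m m \<Longrightarrow> bracket x y \<in> carrier_mat m m"
  unfolding bracket_def by auto

text \<open>
  The derived algebra is an intersection of subspaces, so it is bounded above by exhibiting one
  subspace with all brackets in it.
\<close>

lemma derived_algebra_least: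
  assumes "mat_subspace m S" "\<And>x y. x \<in> q \<Longrightarrow> y \<in> q \<Longrightarrow> bracket x y \<in> S"
  shows "derived_algebra m q \<subseteq> S"
  using assms unfolding derived_algebra_def by blast

lemma bracket_in_derived: "x \<in> q \<Longrightarrow> y \<in> q \<Longrightarrow> bracket x y \<in> derived_algebra m q"
  unfolding derived_algebra_def by blast

lemma derived_algebra_subspace:
  assumes "q \<subseteq> carrier_mat m m"
  shows "mat_subspace m (derived_algebra m q)"
proof (rule mat_subspaceI)
  show "derived_algebra m q \<subseteq> carrier_mat m m"
    by (rule derived_algebra_least[OF mat_subspace_carrier])
      (use assms in \<open>auto intro: bracket_carrier\<close>)
qed (auto simp: derived_algebra_def dest: mat_subspaceD)

lemma derived_algebra_mono: "q \<subseteq> r \<Longrightarrow> derived_algebra m q \<subseteq> derived_algebra m r"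
  unfolding derived_algebra_def by blast

lemma derived_algebra_iter_carrier:
  "q \<subseteq> carrier_mat m m \<Longrightarrow> (derived_algebra m ^^ k) q \<subseteq> carrier_mat m m"
proof (induction k)
  case (Suc k)
  then show ?case using mat_subspaceD(1)[OF derived_algebra_subspace[OF Suc.IH]] by simp
qed simp

lemma derived_algebra_iter_zero:
  assumes q: "mat_subspace m q"
  shows "0\<^sub>m m m \<in> (derived_algebra m ^^ k) q"
proof (cases k)
  case 0
  then show ?thesis using mat_subspaceD(2)[OF q] by simp
next
  case (Suc j)
  have "(derived_algebra m ^^ j) q \<subseteq> carrier_mat m m"
    by (rule derived_algebra_iter_carrier[OF mat_subspaceD(1)[OF q]])
  from mat_subspaceD(2)[OF derived_algebra_subspace[OF this]]
  show ?thesis using Suc by simp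
qed

lemma lie_solvableI:
  assumes "mat_subspace m q" "(derived_algebra m ^^ k) q \<subseteq> {0\<^sub>m m m}"
  shows "lie_solvable m q"
proof -
  have "(derived_algebra m ^^ k) q = {0\<^sub>m m m}"
    using derived_algebra_iter_zero[OF assms(1), of k] assms(2) by (intro subset_antisym) simp_all
  then show ?thesis unfolding lie_solvable_def by (rule exI)
qed

lemma derived_algebra_iter_Ad:
  assumes g: "g \<in> GL m" and q: "q \<subseteq> carrier_mat m m"
  shows "(derived_algebra m ^^ k) (Ad g ` q) \<subseteq> Ad g ` (derived_algebra m ^^ k) q"
proof (induction k)
  case (Suc k)
  let ?D = "(derived_algebra m ^^ k) q"
  have c: "?D \<subseteq> carrier_mat m m" by (rule derived_algebra_iter_carrier[OF q])
  have H: "\<forall>x\<in>Ad g ` ?D. \<forall>y\<in>Ad g ` ?D. bracket x y \<in> Ad g ` derived_algebra m ?D"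
    by (rule bracket_Ad_image[OF g _ c c]) (use bracket_in_derived in blast)
  have "derived_algebra m (Ad g ` ?D) \<subseteq> Ad g ` derived_algebra m ?D"
    by (intro derived_algebra_least mat_subspace_Ad[OF g derived_algebra_subspace[OF c]] H[rule_format])
  then show ?case using derived_algebra_mono[OF Suc, of m] by simp
qed simp

lemma lie_solvable_Ad:
  assumes g: "g \<in> GL m" and q: "mat_subspace m q" and s: "lie_solvable m q"
  shows "lie_solvable m (Ad g ` q)"
proof -
  from s obtain k where "(derived_algebra m ^^ k) q = {0\<^sub>m m m}" unfolding lie_solvable_def by blast
  moreover note mat_subspaceD(1)[OF q]
  ultimately have "(derived_algebra m ^^ k) (Ad g ` q) \<subseteq> {0\<^sub>m m m}"
    using derived_algebra_iter_Ad[OF g, of q k] Ad_zero[OF g] by auto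
  then show ?thesis using lie_solvableI mat_subspace_Ad[OF g q] by blast
qed

lemma borel_subalgebra_Ad:
  assumes g: "g \<in> GL m" and b: "borel_subalgebra m q b" and q: "q \<subseteq> carrier_mat m m"
    and inv: "Ad g ` q = q"
  shows "borel_subalgebra m q (Ad g ` b)"
proof -
  note h = minv_GL[OF g]
  have inv': "Ad (minv g) ` q = q" using Ad_image_minv(1)[OF g q] inv by simp
  have max: "s = Ad g ` b"
    if s: "lie_subalgebra m s" "lie_solvable m s" "Ad g ` b \<subseteq> s" "s \<subseteq> q" for s
  proof -
    have sub: "mat_subspace m s" using s(1) unfolding lie_subalgebra_def by simp
    have "b \<subseteq> q" using b unfolding borel_subalgebra_def by simp
    then have bc: "b \<subseteq> carrier_mat m m" using q by simp
    have "b \<subseteq> Ad (minv g) ` s" using s(3) Ad_image_minv(1)[OF g bc] by (metis image_mono)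
    moreover have "Ad (minv g) ` s \<subseteq> q" using s(4) inv' by (metis image_mono)
    moreover note lie_subalgebra_Ad[OF h s(1)] lie_solvable_Ad[OF h sub s(2)]
    ultimately have "Ad (minv g) ` s = b" using b unfolding borel_subalgebra_def by simp
    then show ?thesis using Ad_image_minv(2)[OF g subset_trans[OF s(4) q]] by simp
  qed
  have B: "lie_subalgebra m b" "lie_solvable m b" "b \<subseteq> q" "mat_subspace m b"
    using b unfolding borel_subalgebra_def lie_subalgebra_def by auto
  have "Ad g ` b \<subseteq> q" using image_mono[OF B(3), of "Ad g"] inv by simp
  then show ?thesis
    unfolding borel_subalgebra_def
    using max lie_subalgebra_Ad[OF g B(1)] lie_solvable_Ad[OF g B(4,2)] by simp
qed

section \<open>Algebras of matrices with prescribed zero entries\<close>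

definition pattern_mats :: "nat \<Rightarrow> (nat \<Rightarrow> nat \<Rightarrow> bool) \<Rightarrow> complex mat set" where
  "pattern_mats m R = {x \<in> carrier_mat m m. \<forall>i < m. \<forall>j < m. \<not> R i j \<longrightarrow> x $$ (i, j) = 0}"

definition matrix_unit :: "nat \<Rightarrow> nat \<Rightarrow> nat \<Rightarrow> complex mat" where
  "matrix_unit m i j = mat m m (\<lambda>(a, b). if a = i \<and> b = j then 1 else 0)"

lemma matrix_unit_carrier [simp]: "matrix_unit m i j \<in> carrier_mat m m"
  unfolding matrix_unit_def by simp

lemma matrix_unit_dim [simp]: "dim_row (matrix_unit m i j) = m" "dim_col (matrix_unit m i j) = m"
  unfolding matrix_unit_def by simp_all

lemma matrix_unit_index [simp]:
  "a < m \<Longrightarrow> b < m \<Longrightarrow> matrix_unit m i j $$ (a, b) = (if a = i \<and> b = j then 1 else 0)"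
  unfolding matrix_unit_def by simp

lemma index_mult_carrier:
  fixes x y :: "complex mat"
  assumes "x \<in> carrier_mat m m" "y \<in> carrier_mat m m" "a < m" "b < m"
  shows "(x * y) $$ (a, b) = (\<Sum>c \<in> {0..<m}. x $$ (a, c) * y $$ (c, b))"
  using assms by (simp add: scalar_prod_def)

lemma bracket_matrix_unit_index:
  assumes x: "x \<in> carrier_mat m m" and "i < m" "j < m" "a < m" "b < m"
  shows "bracket (matrix_unit m i j) x $$ (a, b) =
    (if a = i then x $$ (j, b) else 0) - (if b = j then x $$ (a, i) else 0)"
proof -
  have "(matrix_unit m i j * x) $$ (a, b) = (\<Sum>c \<in> {0..<m}. if c = j then (if a = i then x $$ (c, b) else 0) else 0)"
    unfolding index_mult_carrier[OF matrix_unit_carrier x assms(4,5)]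
    by (rule sum.cong) (use assms in auto)
  moreover have "(x * matrix_unit m i j) $$ (a, b) = (\<Sum>c \<in> {0..<m}. if c = i then (if b = j then x $$ (a, c) else 0) else 0)"
    unfolding index_mult_carrier[OF x matrix_unit_carrier assms(4,5)]
    by (rule sum.cong) (use assms in auto)
  moreover have "matrix_unit m i j * x \<in> carrier_mat m m" "x * matrix_unit m i j \<in> carrier_mat m m"
    using mult_carrier_mat[OF matrix_unit_carrier x] mult_carrier_mat[OF x matrix_unit_carrier] by auto
  ultimately show ?thesis unfolding bracket_def using assms by (simp del: index_mult_mat(1))
qed

text \<open>
  The diagonal matrix units span a torus, and \<open>matrix_unit m i j\<close> spans the weight space of weight
  \<open>\<epsilon>\<^sub>i - \<epsilon>\<^sub>j\<close> in its adjoint action. A subspace stable under the torus is the sum of its weight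
  parts. Concretely, \<open>ad (E\<^sub>i\<^sub>i) (ad (E\<^sub>j\<^sub>j) x)\<close> retains only the entries of \<open>x\<close> at \<open>(i, j)\<close> and
  \<open>(j, i)\<close>, and one further application of \<open>ad (E\<^sub>i\<^sub>i)\<close> changes their relative sign, so the sum of
  the two results isolates the entry at \<open>(i, j)\<close>.
\<close>

lemma weight_vector_extraction:
  assumes S: "mat_subspace m S" and ad: "\<And>k y. k < m \<Longrightarrow> y \<in> S \<Longrightarrow> bracket (matrix_unit m k k) y \<in> S"
    and x: "x \<in> S" and ij: "i < m" "j < m" "i \<noteq> j" and nz: "x $$ (i, j) \<noteq> 0"
  shows "matrix_unit m i j \<in> S"
proof -
  note D = mat_subspaceD[OF S]
  have xc: "x \<in> carrier_mat m m" using D(1) x by blast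
  define z where "z = bracket (matrix_unit m j j) x"
  define c where "c = bracket (matrix_unit m i i) z"
  define d where "d = bracket (matrix_unit m i i) c"
  have zS: "z \<in> S" and cS: "c \<in> S" and dS: "d \<in> S"
    unfolding z_def c_def d_def using ad ij x by auto
  have zc: "z \<in> carrier_mat m m" and cc: "c \<in> carrier_mat m m" and dc: "d \<in> carrier_mat m m"
    using zS cS dS D(1) by auto
  note zi = bracket_matrix_unit_index[OF xc ij(2) ij(2), folded z_def]
  note ci = bracket_matrix_unit_index[OF zc ij(1) ij(1), folded c_def]
  note di = bracket_matrix_unit_index[OF cc ij(1) ij(1), folded d_def]
  have "matrix_unit m i j = (- 1 / (2 * x $$ (i, j))) \<cdot>\<^sub>m (c + d)"
  proof (rule eq_matI)
    fix a b assume "a < dim_row ((- 1 / (2 * x $$ (i, j))) \<cdot>\<^sub>m (c + d))"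
      "b < dim_col ((- 1 / (2 * x $$ (i, j))) \<cdot>\<^sub>m (c + d))"
    then have ab: "a < m" "b < m" using dc by auto
    show "matrix_unit m i j $$ (a, b) = ((- 1 / (2 * x $$ (i, j))) \<cdot>\<^sub>m (c + d)) $$ (a, b)"
      using ab cc dc nz ij by (simp add: di ci zi)
  qed (use dc in \<open>auto simp: matrix_unit_def\<close>)
  then show ?thesis using D(3,4) cS dS by simp
qed

lemma pattern_matsD:
  assumes "x \<in> pattern_mats m R"
  shows "x \<in> carrier_mat m m" "\<And>i j. i < m \<Longrightarrow> j < m \<Longrightarrow> \<not> R i j \<Longrightarrow> x $$ (i, j) = 0"
  using assms unfolding pattern_mats_def by auto

lemma pattern_mats_subspace: "mat_subspace m (pattern_mats m R)"
  by (rule mat_subspaceI) (auto simp: pattern_mats_def)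

lemma matrix_unit_pattern: "R i j \<Longrightarrow> matrix_unit m i j \<in> pattern_mats m R"
  by (auto simp: pattern_mats_def)

lemma pattern_mats_mult:
  assumes x: "x \<in> pattern_mats m R" and y: "y \<in> pattern_mats m S"
    and T: "\<And>i j k. R i j \<Longrightarrow> S j k \<Longrightarrow> T i k"
  shows "x * y \<in> pattern_mats m T"
proof -
  note X = pattern_matsD[OF x] and Y = pattern_matsD[OF y]
  have "(x * y) $$ (i, k) = 0" if "i < m" "k < m" "\<not> T i k" for i k
    unfolding index_mult_carrier[OF X(1) Y(1) that(1,2)]
  proof (rule sum.neutral, intro ballI)
    fix j assume "j \<in> {0..<m}"
    then show "x $$ (i, j) * y $$ (j, k) = 0"
      using X(2)[OF that(1), of j] Y(2)[of j k] T[of i j k] that by auto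
  qed
  then show ?thesis using X(1) Y(1) unfolding pattern_mats_def by (simp del: index_mult_mat)
qed

lemma pattern_mats_minus:
  "x \<in> pattern_mats m R \<Longrightarrow> y \<in> pattern_mats m R \<Longrightarrow> x - y \<in> pattern_mats m R"
  by (auto simp: pattern_mats_def)

lemma pattern_mats_bracket:
  assumes "x \<in> pattern_mats m R" "y \<in> pattern_mats m S"
    and "\<And>i j k. R i j \<Longrightarrow> S j k \<Longrightarrow> T i k" "\<And>i j k. S i j \<Longrightarrow> R j k \<Longrightarrow> T i k"
  shows "bracket x y \<in> pattern_mats m T"
  unfolding bracket_def
  by (intro pattern_mats_minus pattern_mats_mult[OF assms(1,2,3)] pattern_mats_mult[OF assms(2,1,4)])

text \<open>
  The \<open>k\<close>-th power vanishes below the \<open>k\<close>-th superdiagonal.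
\<close>

lemma strictly_upper_nilpotent:
  assumes x: "x \<in> pattern_mats m (<)"
  shows "nilpotent_mat x"
proof -
  note X = pattern_matsD[OF x]
  have "x ^\<^sub>m k \<in> pattern_mats m (\<lambda>i j. i + k \<le> j)" for k
  proof (induction k)
    case 0
    then show ?case using X(1) by (auto simp: pattern_mats_def)
  next
    case (Suc k)
    show ?case using pattern_mats_mult[OF Suc x, of "\<lambda>i j. i + Suc k \<le> j"] by simp
  qed
  from this[of m] have P: "x ^\<^sub>m m \<in> pattern_mats m (\<lambda>i j. i + m \<le> j)" .
  have "x ^\<^sub>m m = 0\<^sub>m m m"
    by (rule eq_matI) (use pattern_matsD[OF P] in auto)
  then show ?thesis unfolding nilpotent_mat_def using X(1) by auto
qed

lemma upper_triangular_mult_diag: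
  assumes x: "x \<in> pattern_mats m (\<le>)" and y: "y \<in> pattern_mats m (\<le>)" and i: "i < m"
  shows "(x * y) $$ (i, i) = x $$ (i, i) * y $$ (i, i)"
proof -
  note X = pattern_matsD[OF x] and Y = pattern_matsD[OF y]
  have "(x * y) $$ (i, i) = (\<Sum>c \<in> {0..<m}. if c = i then x $$ (i, i) * y $$ (i, i) else 0)"
    unfolding index_mult_carrier[OF X(1) Y(1) i i]
  proof (rule sum.cong)
    fix c assume "c \<in> {0..<m}"
    then show "x $$ (i, c) * y $$ (c, i) = (if c = i then x $$ (i, i) * y $$ (i, i) else 0)"
      using X(2)[of i c] Y(2)[of c i] i by (cases "c = i"; cases "c < i") auto
  qed simp
  then show ?thesis using i by simp
qed

text \<open>
  On upper triangular matrices, taking a diagonal entry is multiplicative.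
\<close>

lemma upper_triangular_nilpotent_diag:
  assumes x: "x \<in> pattern_mats m (\<le>)" and nil: "nilpotent_mat x" and i: "i < m"
  shows "x $$ (i, i) = 0"
proof -
  note X = pattern_matsD[OF x]
  have pow: "x ^\<^sub>m k \<in> pattern_mats m (\<le>) \<and> (x ^\<^sub>m k) $$ (i, i) = (x $$ (i, i)) ^ k" for k
  proof (induction k)
    case 0
    then show ?case using X(1) i by (auto simp: pattern_mats_def)
  next
    case (Suc k)
    then have P: "x ^\<^sub>m k \<in> pattern_mats m (\<le>)" by simp
    have "(x ^\<^sub>m Suc k) $$ (i, i) = (x $$ (i, i)) ^ Suc k"
      using Suc upper_triangular_mult_diag[OF P x i] by (simp del: index_mult_mat add: mult.commute)
    moreover have "x ^\<^sub>m Suc k \<in> pattern_mats m (\<le>)"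
      using pattern_mats_mult[OF P x, of "(\<le>)"] by simp
    ultimately show ?case by blast
  qed
  from nil obtain k where "x ^\<^sub>m k = 0\<^sub>m m m" using X(1) unfolding nilpotent_mat_def by auto
  then show ?thesis using pow[of k] i by simp
qed

text \<open>
  The bracket is the diagonal matrix \<open>E\<^sub>i\<^sub>i - E\<^sub>j\<^sub>j\<close>.
\<close>

lemma bracket_opposite_units_not_nilpotent:
  assumes ij: "i < m" "j < m" "i \<noteq> j"
  shows "\<not> nilpotent_mat (bracket (matrix_unit m i j) (matrix_unit m j i))"
proof
  let ?h = "bracket (matrix_unit m i j) (matrix_unit m j i)"
  note h = bracket_matrix_unit_index[OF matrix_unit_carrier ij(1,2)]
  assume "nilpotent_mat ?h"
  moreover have "?h \<in> pattern_mats m (\<le>)"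
    unfolding pattern_mats_def using ij by (auto simp: h bracket_carrier)
  ultimately have "?h $$ (i, i) = 0" using upper_triangular_nilpotent_diag ij by blast
  then show False using ij by (simp add: h)
qed

text \<open>
  The relation \<open>R\<close> is a preorder whose strict part is contained in \<open><\<close>; this covers Borel subalgebras
  (\<open>R\<close> antisymmetric) and parabolic ones. An ideal of nilpotent matrices is stable under the torus. If
  it had an element with a nonzero entry at \<open>(i, j)\<close> with both \<open>R i j\<close> and \<open>R j i\<close>, it would
  contain \<open>E\<^sub>i\<^sub>j\<close>, hence also its bracket with \<open>E\<^sub>j\<^sub>i\<close>, which is not nilpotent. The only further entries outside
  the strict part of \<open>R\<close> lie on the diagonal, which vanishes for an upper triangular nilpotent matrix.
\<close>

lemma nilradical_pattern:
  assumes refl: "\<And>i. R i i" and trans: "\<And>i j k. R i j \<Longrightarrow> R j k \<Longrightarrow> R i k"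
    and ord: "\<And>i j. R i j \<Longrightarrow> \<not> R j i \<Longrightarrow> i < j"
  shows "nilradical m (pattern_mats m R) = pattern_mats m (\<lambda>i j. R i j \<and> \<not> R j i)"
    (is "_ = ?U")
proof
  show "nilradical m (pattern_mats m R) \<subseteq> ?U"
  proof
    fix x assume "x \<in> nilradical m (pattern_mats m R)"
    then obtain I where I: "lie_ideal m I (pattern_mats m R)" "\<forall>x\<in>I. nilpotent_mat x" "x \<in> I"
      unfolding nilradical_def by blast
    have sub: "mat_subspace m I" and IR: "I \<subseteq> pattern_mats m R"
      and br: "\<And>y z. y \<in> pattern_mats m R \<Longrightarrow> z \<in> I \<Longrightarrow> bracket y z \<in> I"
      using I(1) unfolding lie_ideal_def by auto
    have xR: "x \<in> pattern_mats m R" using IR I(3) by blast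
    note X = pattern_matsD[OF xR]
    have off: "x $$ (i, j) = 0" if ij: "i < m" "j < m" "i \<noteq> j" and R: "\<not> (R i j \<and> \<not> R j i)" for i j
    proof (rule ccontr)
      assume nz: "x $$ (i, j) \<noteq> 0"
      then have "R j i" using X(2) ij R by blast
      then have "matrix_unit m j i \<in> pattern_mats m R" by (rule matrix_unit_pattern)
      moreover have "matrix_unit m i j \<in> I"
        by (rule weight_vector_extraction[OF sub _ I(3) ij nz]) (use br matrix_unit_pattern refl in blast)
      ultimately have "nilpotent_mat (bracket (matrix_unit m j i) (matrix_unit m i j))" using br I(2) by blast
      then show False using bracket_opposite_units_not_nilpotent[of j m i] ij by simp
    qed
    have "x $$ (i, j) = 0" if "i < m" "j < m" "j < i" for i j
      using off[of i j] ord[of i j] that by force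
    then have "x \<in> pattern_mats m (\<le>)"
      unfolding pattern_mats_def using X(1) by (simp add: not_le)
    then have "x $$ (i, i) = 0" if "i < m" for i
      using upper_triangular_nilpotent_diag I that by blast
    then have "x $$ (i, j) = 0" if "i < m" "j < m" "\<not> (R i j \<and> \<not> R j i)" for i j
      using off[of i j] that by (cases "i = j") auto
    then show "x \<in> ?U" using X(1) unfolding pattern_mats_def by simp
  qed
  have "lie_ideal m ?U (pattern_mats m R)"
    unfolding lie_ideal_def
  proof (intro conjI ballI pattern_mats_subspace)
    show "?U \<subseteq> pattern_mats m R" unfolding pattern_mats_def by auto
    show "bracket x y \<in> ?U" if "x \<in> pattern_mats m R" "y \<in> ?U" for x y
      by (rule pattern_mats_bracket[OF that]) (use trans in blast)+
  qed
  moreover have "nilpotent_mat x" if "x \<in> ?U" for x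
    by (rule strictly_upper_nilpotent) (use that ord in \<open>auto simp: pattern_mats_def\<close>)
  ultimately show "?U \<subseteq> nilradical m (pattern_mats m R)" unfolding nilradical_def by blast
qed

text \<open>
  The elements \<open>E\<^sub>i\<^sub>j\<close>, \<open>E\<^sub>j\<^sub>i\<close> and their bracket span a copy of \<open>sl\<^sub>2\<close>, which equals its own derived
  algebra and so survives in every term of the derived series.
\<close>

lemma opposite_units_not_solvable:
  assumes s: "lie_subalgebra m s" and ij: "i < m" "j < m" "i \<noteq> j"
    and e: "matrix_unit m i j \<in> s" and f: "matrix_unit m j i \<in> s"
  shows "\<not> lie_solvable m s"
proof
  assume "lie_solvable m s"
  then obtain k where k: "(derived_algebra m ^^ k) s = {0\<^sub>m m m}" unfolding lie_solvable_def by blast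
  let ?e = "matrix_unit m i j" and ?f = "matrix_unit m j i"
  let ?h = "bracket ?e ?f"
  have sub: "mat_subspace m s" and br: "?h \<in> s" using s e f unfolding lie_subalgebra_def by auto
  note sc = mat_subspaceD(1)[OF sub]
  note hi = bracket_matrix_unit_index[OF matrix_unit_carrier ij(1,2)]
  have hc: "?h \<in> carrier_mat m m" by (simp add: bracket_carrier)
  note ehi = bracket_matrix_unit_index[OF hc ij(1,2)] and fhi = bracket_matrix_unit_index[OF hc ij(2,1)]
  have c: "bracket ?e ?h \<in> carrier_mat m m" "bracket ?f ?h \<in> carrier_mat m m"
    using bracket_carrier hc by auto
  have eh: "?e = (- 1 / 2) \<cdot>\<^sub>m bracket ?e ?h"
    by (rule eq_matI) (use ij c in \<open>auto simp: ehi hi\<close>)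
  have fh: "?f = (1 / 2) \<cdot>\<^sub>m bracket ?f ?h"
    by (rule eq_matI) (use ij c in \<open>auto simp: fhi hi\<close>)
  have "?e \<in> (derived_algebra m ^^ k) s \<and> ?f \<in> (derived_algebra m ^^ k) s
      \<and> ?h \<in> (derived_algebra m ^^ k) s" for k
  proof (induction k)
    case 0
    then show ?case using e f br by simp
  next
    case (Suc k)
    let ?D = "(derived_algebra m ^^ k) s"
    note D = mat_subspaceD[OF derived_algebra_subspace[OF derived_algebra_iter_carrier[OF sc, of k]]]
    have "bracket ?e ?h \<in> derived_algebra m ?D" "bracket ?f ?h \<in> derived_algebra m ?D"
      "?h \<in> derived_algebra m ?D"
      using Suc bracket_in_derived by blast+
    then show ?case using D(4) eh fh by (metis funpow.simps(2) o_apply)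
  qed
  from this[of k] have "?e = 0\<^sub>m m m" using k by blast
  then have "?e $$ (i, j) = 0" using ij by simp
  then show False using ij by simp
qed

text \<open>
  For an equivalence relation \<open>Q\<close> the pattern algebra is a Levi subalgebra, up to reordering the basis.
  A subalgebra of it that strictly contains the triangular part contains some \<open>E\<^sub>i\<^sub>j\<close> with \<open>i > j\<close>, by
  extraction of weight vectors, as well as \<open>E\<^sub>j\<^sub>i\<close>, so it cannot be solvable. Solvability of the
  triangular part follows from the filtration by superdiagonals.
\<close>

lemma borel_subalgebra_pattern:
  assumes refl: "\<And>i. Q i i" and trans: "\<And>i j k. Q i j \<Longrightarrow> Q j k \<Longrightarrow> Q i k"
    and sym: "\<And>i j. Q i j \<Longrightarrow> Q j i"
  shows "borel_subalgebra m (pattern_mats m Q) (pattern_mats m (\<lambda>i j. Q i j \<and> i \<le> j))"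
    (is "borel_subalgebra m ?q ?b")
  unfolding borel_subalgebra_def
proof (intro conjI allI impI)
  show lb: "lie_subalgebra m ?b"
    unfolding lie_subalgebra_def
  proof (intro conjI ballI pattern_mats_subspace)
    show "bracket x y \<in> ?b" if "x \<in> ?b" "y \<in> ?b" for x y
      by (rule pattern_mats_bracket[OF that]) (use trans in force)+
  qed
  show "?b \<subseteq> ?q" by (auto simp: pattern_mats_def)
  have bu: "?b \<subseteq> pattern_mats m (\<le>)" by (auto simp: pattern_mats_def)
  \<comment> \<open>The first derived algebra has zero diagonal, because \<open>x y\<close> and \<open>y x\<close> have the same
    diagonal for upper triangular \<open>x\<close> and \<open>y\<close>.
    After that, the bracket of two matrices supported on and above the \<open>k\<close>-th superdiagonal is
    supported on and above the \<open>2 k\<close>-th, which for \<open>k \<ge> 1\<close> gains at least one superdiagonal.\<close>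
  have filt: "(derived_algebra m ^^ Suc k) ?b \<subseteq> pattern_mats m (\<lambda>i j. i + Suc k \<le> j)" for k
  proof (induction k)
    case 0
    have "bracket x y \<in> pattern_mats m (\<lambda>i j. i + Suc 0 \<le> j)"
      if x: "x \<in> pattern_mats m (\<le>)" and y: "y \<in> pattern_mats m (\<le>)" for x y
    proof -
      note X = pattern_matsD[OF x] and Y = pattern_matsD[OF y]
      have "bracket x y \<in> pattern_mats m (\<le>)" by (rule pattern_mats_bracket[OF x y]) auto
      note B = pattern_matsD[OF this]
      have diag: "bracket x y $$ (i, i) = 0" if i: "i < m" for i
      proof -
        have "bracket x y $$ (i, i) = (x * y) $$ (i, i) - (y * x) $$ (i, i)"
          unfolding bracket_def using X(1) Y(1) i by (simp del: index_mult_mat(1))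
        then show ?thesis
          using upper_triangular_mult_diag[OF x y i] upper_triangular_mult_diag[OF y x i] by simp
      qed
      have "bracket x y $$ (i, j) = 0" if "i < m" "j < m" "\<not> i + Suc 0 \<le> j" for i j
        using B(2)[of i j] diag[of i] that by (cases "i = j") auto
      then show ?thesis unfolding pattern_mats_def using B(1) by simp
    qed
    then have "derived_algebra m (pattern_mats m (\<le>)) \<subseteq> pattern_mats m (\<lambda>i j. i + Suc 0 \<le> j)"
      by (intro derived_algebra_least pattern_mats_subspace)
    then show ?case using derived_algebra_mono[OF bu, of m] by simp
  next
    case (Suc k)
    let ?F = "\<lambda>k. pattern_mats m (\<lambda>i j. i + Suc k \<le> j)"
    have "bracket x y \<in> ?F (Suc k)" if "x \<in> ?F k" "y \<in> ?F k" for x y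
      by (rule pattern_mats_bracket[OF that]) auto
    then have "derived_algebra m (?F k) \<subseteq> ?F (Suc k)"
      by (intro derived_algebra_least pattern_mats_subspace)
    then show ?case using derived_algebra_mono[OF Suc, of m] by simp
  qed
  have "pattern_mats m (\<lambda>i j. i + Suc m \<le> j) \<subseteq> {0\<^sub>m m m}"
  proof
    fix x assume x: "x \<in> pattern_mats m (\<lambda>i j. i + Suc m \<le> j)"
    have "x = 0\<^sub>m m m" by (rule eq_matI) (use pattern_matsD[OF x] in auto)
    then show "x \<in> {0\<^sub>m m m}" by simp
  qed
  then show "lie_solvable m ?b"
    using filt[of m] by (intro lie_solvableI[OF pattern_mats_subspace]) (rule subset_trans)
  fix s assume s: "lie_subalgebra m s \<and> lie_solvable m s \<and> ?b \<subseteq> s \<and> s \<subseteq> ?q"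
  then have sub: "mat_subspace m s" and br: "\<And>x y. x \<in> s \<Longrightarrow> y \<in> s \<Longrightarrow> bracket x y \<in> s"
    unfolding lie_subalgebra_def by auto
  show "s = ?b"
  proof (rule ccontr)
    assume "s \<noteq> ?b"
    then obtain x where x: "x \<in> s" "x \<notin> ?b" using s by blast
    then have xq: "x \<in> ?q" using s by blast
    obtain i j where ij: "i < m" "j < m" "\<not> (Q i j \<and> i \<le> j)" "x $$ (i, j) \<noteq> 0"
      using x(2) pattern_matsD(1)[OF xq] unfolding pattern_mats_def by blast
    then have Q: "Q j i" "j < i" using pattern_matsD(2)[OF xq] sym by (auto simp: not_le)
    have "matrix_unit m k k \<in> s" for k
      using s matrix_unit_pattern[of "\<lambda>i j. Q i j \<and> i \<le> j" k k m] refl by auto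
    then have "matrix_unit m i j \<in> s"
      using Q by (intro weight_vector_extraction[OF sub _ x(1) ij(1,2) _ ij(4)] br) auto
    moreover have "matrix_unit m j i \<in> s"
      using s matrix_unit_pattern[of "\<lambda>i j. Q i j \<and> i \<le> j" j i m] Q by auto
    ultimately show False
      using opposite_units_not_solvable[of m s i j] s ij(1,2) Q by auto
  qed
qed

section \<open>The symmetric pair in terms of blocks\<close>

definition same_block :: "nat \<Rightarrow> nat \<Rightarrow> nat \<Rightarrow> bool" where
  "same_block n i j \<longleftrightarrow> (i < n \<longleftrightarrow> j < n)"

lemma block_diag_carrier:
  "x \<in> carrier_mat n n \<Longrightarrow> y \<in> carrier_mat n n \<Longrightarrow> block_diag x y \<in> carrier_mat (n + n) (n + n)"
  unfolding block_diag_def by auto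

lemma block_diag_alt:
  "x \<in> carrier_mat n n \<Longrightarrow> y \<in> carrier_mat n n \<Longrightarrow>
    block_diag x y = four_block_mat x (0\<^sub>m n n) (0\<^sub>m n n) y"
  unfolding block_diag_def by auto

lemma block_diag_index:
  assumes "x \<in> carrier_mat n n" "y \<in> carrier_mat n n" "i < n + n" "j < n + n"
  shows "block_diag x y $$ (i, j) =
    (if i < n then if j < n then x $$ (i, j) else 0
     else if j < n then 0 else y $$ (i - n, j - n))"
  using assms unfolding block_diag_def by auto

definition upper_left :: "nat \<Rightarrow> complex mat \<Rightarrow> complex mat" where
  "upper_left n x = mat n n (\<lambda>(i, j). x $$ (i, j))"

definition lower_right :: "nat \<Rightarrow> complex mat \<Rightarrow> complex mat" where
  "lower_right n x = mat n n (\<lambda>(i, j). x $$ (i + n, j + n))"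

lemma blocks_carrier [simp]:
  "upper_left n x \<in> carrier_mat n n" "lower_right n x \<in> carrier_mat n n"
  unfolding upper_left_def lower_right_def by simp_all

lemma blocks_four_block [simp]:
  assumes "a \<in> carrier_mat n n" "b \<in> carrier_mat n n" "c \<in> carrier_mat n n" "d \<in> carrier_mat n n"
  shows "upper_left n (four_block_mat a b c d) = a" "lower_right n (four_block_mat a b c d) = d"
  using assms unfolding upper_left_def lower_right_def by (auto intro!: eq_matI)

lemma blocks_block_diag:
  assumes "x \<in> carrier_mat n n" "y \<in> carrier_mat n n"
  shows "upper_left n (block_diag x y) = x" "lower_right n (block_diag x y) = y"
  using assms by (simp_all add: block_diag_alt[OF assms])

text \<open>
  For matrices of the right size the diagonal part depends on the two diagonal blocks only, which are
  total functions and easier to transport than the quadruple of blocks.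
\<close>

lemma theta_part_eq:
  assumes "x \<in> carrier_mat (n + n) (n + n)"
  shows "theta_part n x = block_diag (upper_left n x) (lower_right n x)"
  using assms unfolding theta_part_def split_block_def Let_def upper_left_def lower_right_def
  by (auto simp: case_prod_beta)

lemma four_block_cases:
  fixes x :: "complex mat"
  assumes "x \<in> carrier_mat (n + n) (n + n)"
  obtains a b c d where "a \<in> carrier_mat n n" "b \<in> carrier_mat n n" "c \<in> carrier_mat n n"
    "d \<in> carrier_mat n n" "x = four_block_mat a b c d"
proof -
  obtain a b c d where s: "split_block x n n = (a, b, c, d)" by (cases "split_block x n n") auto
  from split_block[OF s, of n n] assms that show ?thesis by auto
qed

text \<open>
  This places all block diagonal algebras of the symmetric pair among the pattern algebras.
\<close>

lemma block_diags_pattern: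
  "block_diags (pattern_mats n R) (pattern_mats n S) =
    pattern_mats (n + n) (\<lambda>i j. same_block n i j \<and> (if i < n then R i j else S (i - n) (j - n)))"
  (is "?L = ?P")
proof
  show "?L \<subseteq> ?P"
  proof
    fix z assume "z \<in> ?L"
    then obtain x y where x: "x \<in> pattern_mats n R" and y: "y \<in> pattern_mats n S"
      and z: "z = block_diag x y" unfolding block_diags_def by blast
    note X = pattern_matsD[OF x] and Y = pattern_matsD[OF y]
    show "z \<in> ?P" unfolding z pattern_mats_def same_block_def
      using X Y block_diag_carrier[OF X(1) Y(1)] by (auto simp: block_diag_index)
  qed
  show "?P \<subseteq> ?L"
  proof
    fix z assume z: "z \<in> ?P"
    note Z = pattern_matsD[OF z]
    have "z = block_diag (upper_left n z) (lower_right n z)"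
      by (rule eq_matI)
        (use Z in \<open>auto simp: block_diag_index[where n = n] upper_left_def lower_right_def same_block_def block_diag_def\<close>)
    moreover have "upper_left n z \<in> pattern_mats n R" "lower_right n z \<in> pattern_mats n S"
      unfolding pattern_mats_def upper_left_def lower_right_def
      using Z(2) by (auto simp: same_block_def)
    ultimately show "z \<in> ?L" unfolding block_diags_def by blast
  qed
qed

lemma carrier_mat_pattern: "carrier_mat m m = pattern_mats m (\<lambda>_ _. True)"
  unfolding pattern_mats_def by simp

lemma upper_triangular_pattern: "upper_triangular_mats n = pattern_mats n (\<le>)"
  unfolding pattern_mats_def upper_triangular_mats_def upper_triangular_def by (auto simp: not_le)

lemma strictly_upper_pattern: "strictly_upper_mats n = pattern_mats n (<)"
  unfolding pattern_mats_def strictly_upper_mats_def by (auto simp: not_less)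

lemma K_lie_pattern: "K_lie n = pattern_mats (n + n) (same_block n)"
  unfolding K_lie_def carrier_mat_pattern block_diags_pattern by simp

lemma BK_lie_pattern: "BK_lie n = pattern_mats (n + n) (\<lambda>i j. same_block n i j \<and> i \<le> j)"
proof -
  have "(\<lambda>i j. same_block n i j \<and> (if i < n then i \<le> j else i - n \<le> j - n))
      = (\<lambda>i j. same_block n i j \<and> i \<le> j)"
    by (intro ext) (auto simp: same_block_def)
  then show ?thesis unfolding BK_lie_def upper_triangular_pattern block_diags_pattern by simp
qed

lemma borel_subalgebra_BK_lie: "borel_subalgebra (n + n) (K_lie n) (BK_lie n)"
  unfolding K_lie_pattern BK_lie_pattern
  by (rule borel_subalgebra_pattern) (auto simp: same_block_def)

lemma nilradical_BK_lie:
  "nilradical (n + n) (BK_lie n) = block_diags (strictly_upper_mats n) (strictly_upper_mats n)"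
proof -
  have "nilradical (n + n) (BK_lie n) = pattern_mats (n + n)
      (\<lambda>i j. (same_block n i j \<and> i \<le> j) \<and> \<not> (same_block n j i \<and> j \<le> i))"
    unfolding BK_lie_pattern by (rule nilradical_pattern) (auto simp: same_block_def)
  moreover have "(\<lambda>i j. (same_block n i j \<and> i \<le> j) \<and> \<not> (same_block n j i \<and> j \<le> i))
      = (\<lambda>i j. same_block n i j \<and> (if i < n then i < j else i - n < j - n))"
    by (intro ext) (auto simp: same_block_def)
  ultimately show ?thesis unfolding strictly_upper_pattern block_diags_pattern by simp
qed

text \<open>
  Stabilizing \<open>\<complex>\<^sup>n \<oplus> 0\<close> means that the lower left block vanishes, as one sees on the unit vectors.
\<close>

lemma PS_lie_pattern: "PS_lie n = pattern_mats (n + n) (\<lambda>i j. i < n \<or> n \<le> j)"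
proof (intro Set.set_eqI iffI)
  fix x assume x: "x \<in> PS_lie n"
  then have xc: "x \<in> carrier_mat (n + n) (n + n)"
    and st: "\<And>v. v \<in> carrier_vec n \<Longrightarrow> \<exists>u \<in> carrier_vec n. x *\<^sub>v (v @\<^sub>v 0\<^sub>v n) = u @\<^sub>v 0\<^sub>v n"
    unfolding PS_lie_def stabilizer_algebra_def by blast+
  have "x $$ (i, j) = 0" if ij: "i < n + n" "j < n + n" "\<not> (i < n \<or> n \<le> j)" for i j
  proof -
    have "(unit_vec n j @\<^sub>v 0\<^sub>v n :: complex vec) = unit_vec (n + n) j"
      using ij by (intro eq_vecI) auto
    moreover obtain u where u: "u \<in> carrier_vec n"
      "x *\<^sub>v (unit_vec n j @\<^sub>v 0\<^sub>v n) = u @\<^sub>v 0\<^sub>v n" using st[of "unit_vec n j"] by auto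
    ultimately have "x *\<^sub>v unit_vec (n + n) j = u @\<^sub>v 0\<^sub>v n" by simp
    then have "(x *\<^sub>v unit_vec (n + n) j) $ i = 0" using u(1) ij by simp
    then show ?thesis using xc ij by simp
  qed
  then show "x \<in> pattern_mats (n + n) (\<lambda>i j. i < n \<or> n \<le> j)"
    unfolding pattern_mats_def using xc by blast
next
  fix x assume x: "x \<in> pattern_mats (n + n) (\<lambda>i j. i < n \<or> n \<le> j)"
  note X = pattern_matsD[OF x]
  obtain a b c d where abcd: "a \<in> carrier_mat n n" "b \<in> carrier_mat n n" "c \<in> carrier_mat n n"
    "d \<in> carrier_mat n n" "x = four_block_mat a b c d" using four_block_cases[OF X(1)] by blast
  have c0: "c = 0\<^sub>m n n"
  proof (rule eq_matI)
    fix i j assume ij: "i < dim_row (0\<^sub>m n n :: complex mat)" "j < dim_col (0\<^sub>m n n :: complex mat)"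
    then have "x $$ (i + n, j) = c $$ (i, j)" using abcd by simp
    then show "c $$ (i, j) = 0\<^sub>m n n $$ (i, j)" using X(2)[of "i + n" j] ij by simp
  qed (use abcd in auto)
  have "x *\<^sub>v (v @\<^sub>v 0\<^sub>v n) = (a *\<^sub>v v) @\<^sub>v 0\<^sub>v n" if v: "v \<in> carrier_vec n" for v
  proof -
    have "b *\<^sub>v 0\<^sub>v n = 0\<^sub>v n" "d *\<^sub>v 0\<^sub>v n = 0\<^sub>v n" "0\<^sub>m n n *\<^sub>v v = 0\<^sub>v n"
      using abcd(2,4) v by (auto intro!: eq_vecI)
    then show ?thesis unfolding abcd(5) c0
      using four_block_mat_mult_vec[OF abcd(1,2) _ abcd(4) v, of "0\<^sub>m n n" "0\<^sub>v n"] abcd(1) v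
      by simp
  qed
  moreover have "a *\<^sub>v v \<in> carrier_vec n" if "v \<in> carrier_vec n" for v using abcd(1) that by simp
  ultimately show "x \<in> PS_lie n" unfolding PS_lie_def stabilizer_algebra_def using X(1) by blast
qed

lemma nilradical_PS_lie:
  "nilradical (n + n) (PS_lie n) =
    (\<lambda>a. four_block_mat (0\<^sub>m n n) a (0\<^sub>m n n) (0\<^sub>m n n)) ` carrier_mat n n"
proof -
  have "nilradical (n + n) (PS_lie n)
      = pattern_mats (n + n) (\<lambda>i j. (i < n \<or> n \<le> j) \<and> \<not> (j < n \<or> n \<le> i))"
    unfolding PS_lie_pattern by (rule nilradical_pattern) auto
  also have "\<dots> = (\<lambda>a. four_block_mat (0\<^sub>m n n) a (0\<^sub>m n n) (0\<^sub>m n n)) ` carrier_mat n n"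
  proof (intro Set.set_eqI iffI)
    fix x assume x: "x \<in> pattern_mats (n + n) (\<lambda>i j. (i < n \<or> n \<le> j) \<and> \<not> (j < n \<or> n \<le> i))"
    note X = pattern_matsD[OF x]
    have "x = four_block_mat (0\<^sub>m n n) (mat n n (\<lambda>(i, j). x $$ (i, j + n))) (0\<^sub>m n n) (0\<^sub>m n n)"
      by (rule eq_matI) (use X in auto)
    then show "x \<in> (\<lambda>a. four_block_mat (0\<^sub>m n n) a (0\<^sub>m n n) (0\<^sub>m n n)) ` carrier_mat n n"
      by (rule image_eqI) simp
  qed (auto simp: pattern_mats_def)
  finally show ?thesis .
qed

text \<open>
  Conjugation carries the stabilizer of \<open>W\<close> into that of \<open>g W\<close>. Applied to the inverse of \<open>g\<close>, the
  same inclusion gives equality.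
\<close>

lemma stabilizer_algebra_image:
  assumes g: "g \<in> GL m" and W: "W \<subseteq> carrier_vec m"
  shows "stabilizer_algebra m ((\<lambda>w. g *\<^sub>v w) ` W) = Ad g ` stabilizer_algebra m W"
proof -
  have cancel: "h *\<^sub>v (g *\<^sub>v w) = w"
    if "g \<in> carrier_mat m m" "h \<in> carrier_mat m m" "h * g = 1\<^sub>m m" "w \<in> carrier_vec m"
    for g h :: "complex mat" and w
    using assoc_mult_mat_vec[OF that(2,1,4)] that by simp
  have le: "Ad g ` stabilizer_algebra m W \<subseteq> stabilizer_algebra m ((\<lambda>w. g *\<^sub>v w) ` W)"
    if g: "g \<in> GL m" and W: "W \<subseteq> carrier_vec m" for g W
  proof
    fix y assume "y \<in> Ad g ` stabilizer_algebra m W"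
    then obtain x where x: "x \<in> carrier_mat m m" "\<forall>w\<in>W. x *\<^sub>v w \<in> W" "y = Ad g x"
      unfolding stabilizer_algebra_def by blast
    note c = GL_carrier[OF g] minv_props[OF g]
    have "y *\<^sub>v (g *\<^sub>v w) = g *\<^sub>v (x *\<^sub>v w)" if "w \<in> W" for w
    proof -
      have w: "w \<in> carrier_vec m" using that W by blast
      have "y *\<^sub>v (g *\<^sub>v w) = (g * x) *\<^sub>v (minv g *\<^sub>v (g *\<^sub>v w))"
        unfolding x(3) Ad_def using c x(1) w
        by (intro assoc_mult_mat_vec[of _ m m _ m]) auto
      also have "\<dots> = g *\<^sub>v (x *\<^sub>v w)"
        using cancel[OF c(1,2,4) w] assoc_mult_mat_vec[OF c(1) x(1) w] by simp
      finally show ?thesis .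
    qed
    then show "y \<in> stabilizer_algebra m ((\<lambda>w. g *\<^sub>v w) ` W)"
      unfolding stabilizer_algebra_def using x Ad_carrier[OF g x(1)] by auto
  qed
  show ?thesis
  proof
    let ?S = "stabilizer_algebra m ((\<lambda>w. g *\<^sub>v w) ` W)"
    note c = GL_carrier[OF g] minv_props[OF g]
    have "(\<lambda>w. g *\<^sub>v w) ` W \<subseteq> carrier_vec m" using W c by auto
    from le[OF minv_GL[OF g] this]
    have "Ad (minv g) ` ?S \<subseteq> stabilizer_algebra m ((\<lambda>w. minv g *\<^sub>v w) ` (\<lambda>w. g *\<^sub>v w) ` W)" .
    moreover have "(\<lambda>w. minv g *\<^sub>v w) ` (\<lambda>w. g *\<^sub>v w) ` W = (\<lambda>w. w) ` W"
      unfolding image_image by (rule image_cong) (use cancel[OF c(1,2,4)] W in auto)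
    ultimately have "Ad (minv g) ` ?S \<subseteq> stabilizer_algebra m W" by simp
    then have "Ad g ` Ad (minv g) ` ?S \<subseteq> Ad g ` stabilizer_algebra m W" by (rule image_mono)
    moreover have "?S \<subseteq> carrier_mat m m" unfolding stabilizer_algebra_def by blast
    ultimately show "?S \<subseteq> Ad g ` stabilizer_algebra m W"
      using Ad_image_minv(2)[OF g] by simp
  qed (rule le[OF g W])
qed

lemma block_diag_mult:
  assumes "a \<in> carrier_mat n n" "b \<in> carrier_mat n n" "c \<in> carrier_mat n n" "d \<in> carrier_mat n n"
  shows "block_diag a b * block_diag c d = block_diag (a * c) (b * d)"
  using assms mult_four_block_mat[of a n n "0\<^sub>m n n" n "0\<^sub>m n n" n b c n "0\<^sub>m n n" n "0\<^sub>m n n" d]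
  by (simp add: block_diag_alt[of _ n])

lemma block_diag_GL:
  assumes g: "g \<in> GL n" and h: "h \<in> GL n"
  shows "block_diag g h \<in> GL (n + n)" "minv (block_diag g h) = block_diag (minv g) (minv h)"
proof -
  note c = GL_carrier[OF g] GL_carrier[OF h] minv_props[OF g] minv_props[OF h]
  have 1: "block_diag g h * block_diag (minv g) (minv h) = 1\<^sub>m (n + n)"
    "block_diag (minv g) (minv h) * block_diag g h = 1\<^sub>m (n + n)"
    using c by (simp_all add: block_diag_mult[of _ n]) (simp_all add: block_diag_alt[of _ n])
  have 2: "block_diag g h \<in> carrier_mat (n + n) (n + n)"
    "block_diag (minv g) (minv h) \<in> carrier_mat (n + n) (n + n)"
    using c block_diag_carrier by blast+
  show "block_diag g h \<in> GL (n + n)" using GL_I[OF 2 1] .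
  show "minv (block_diag g h) = block_diag (minv g) (minv h)" using minv_unique[OF 2 1] .
qed

lemma blocks_Ad_block_diag:
  assumes g: "g \<in> GL n" and h: "h \<in> GL n" and x: "x \<in> carrier_mat (n + n) (n + n)"
  shows "upper_left n (Ad (block_diag g h) x) = Ad g (upper_left n x)"
    "lower_right n (Ad (block_diag g h) x) = Ad h (lower_right n x)"
proof -
  obtain a b c d where abcd: "a \<in> carrier_mat n n" "b \<in> carrier_mat n n" "c \<in> carrier_mat n n"
    "d \<in> carrier_mat n n" "x = four_block_mat a b c d" using four_block_cases[OF x] by blast
  note gh = GL_carrier[OF g] GL_carrier[OF h] minv_props(1)[OF g] minv_props(1)[OF h]
  have 1: "block_diag g h * x = four_block_mat (g * a) (g * b) (h * c) (h * d)"
    using gh abcd mult_four_block_mat[of g n n "0\<^sub>m n n" n "0\<^sub>m n n" n h a n b n c d]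
    by (simp add: block_diag_alt[of _ n])
  have "four_block_mat (g * a) (g * b) (h * c) (h * d) * block_diag (minv g) (minv h)
      = four_block_mat (g * a * minv g) (g * b * minv h) (h * c * minv g) (h * d * minv h)"
    using gh abcd mult_four_block_mat[of "g * a" n n "g * b" n "h * c" n "h * d"
        "minv g" n "0\<^sub>m n n" n "0\<^sub>m n n" "minv h"]
    by (simp add: block_diag_alt[of _ n])
  then have "Ad (block_diag g h) x
      = four_block_mat (Ad g a) (g * b * minv h) (h * c * minv g) (Ad h d)"
    unfolding Ad_def block_diag_GL(2)[OF g h] 1 by simp
  then show "upper_left n (Ad (block_diag g h) x) = Ad g (upper_left n x)"
    "lower_right n (Ad (block_diag g h) x) = Ad h (lower_right n x)"
    using abcd gh Ad_carrier[OF g] Ad_carrier[OF h] by simp_all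
qed

lemma Ad_block_diag:
  assumes g: "g \<in> GL n" and h: "h \<in> GL n" and x: "x \<in> carrier_mat n n" "y \<in> carrier_mat n n"
  shows "Ad (block_diag g h) (block_diag x y) = block_diag (Ad g x) (Ad h y)"
  unfolding Ad_def block_diag_GL(2)[OF g h]
  using x GL_carrier[OF g] GL_carrier[OF h] minv_props(1)[OF g] minv_props(1)[OF h]
  by (simp add: block_diag_mult[of _ n])

lemma theta_part_Ad:
  assumes "g \<in> GL n" "h \<in> GL n" "x \<in> carrier_mat (n + n) (n + n)"
  shows "theta_part n (Ad (block_diag g h) x) = Ad (block_diag g h) (theta_part n x)"
  using assms Ad_carrier[OF block_diag_GL(1)[OF assms(1,2)] assms(3)]
  by (simp add: theta_part_eq blocks_Ad_block_diag Ad_block_diag)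

lemma Ad_K_lie:
  assumes g: "g \<in> GL n" and h: "h \<in> GL n"
  shows "Ad (block_diag g h) ` K_lie n = K_lie n"
proof -
  have K: "K_lie n \<subseteq> carrier_mat (n + n) (n + n)"
    unfolding K_lie_pattern pattern_mats_def by blast
  have le: "Ad (block_diag g h) ` K_lie n \<subseteq> K_lie n" if "g \<in> GL n" "h \<in> GL n" for g h
    unfolding K_lie_def block_diags_def
    using Ad_block_diag[OF that] Ad_carrier[OF that(1)] Ad_carrier[OF that(2)] by auto blast
  show ?thesis
  proof (rule subset_antisym[OF le[OF g h]])
    have "Ad (minv (block_diag g h)) ` K_lie n \<subseteq> K_lie n"
      unfolding block_diag_GL(2)[OF g h] using le minv_GL g h by blast
    then have "Ad (block_diag g h) ` Ad (minv (block_diag g h)) ` K_lie n \<subseteq> Ad (block_diag g h) ` K_lie n"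
      by (rule image_mono)
    then show "K_lie n \<subseteq> Ad (block_diag g h) ` K_lie n"
      using Ad_image_minv(2)[OF block_diag_GL(1)[OF g h] K] by simp
  qed
qed

section \<open>Zariski closure and polynomial maps\<close>

text \<open>
  The pullback of a coordinate function need only agree with a polynomial function on \<open>V\<close>, since
  matrix operations are not given by polynomials in the entries on matrices of the wrong size.
\<close>

definition regular_map ::
  "('a \<Rightarrow> complex) set \<Rightarrow> 'a set \<Rightarrow> ('b \<Rightarrow> complex) set \<Rightarrow> ('a \<Rightarrow> 'b) \<Rightarrow> bool" where
  "regular_map X V Y \<phi> \<longleftrightarrow> (\<forall>y \<in> Y. \<exists>p \<in> poly_funs X. \<forall>v \<in> V. y (\<phi> v) = p v)"

lemma regular_map_pullback:
  assumes r: "regular_map X V Y \<phi>" and f: "f \<in> poly_funs Y"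
  shows "\<exists>p \<in> poly_funs X. \<forall>v \<in> V. f (\<phi> v) = p v"
  using f
proof induction
  case (coord f)
  then show ?case using r unfolding regular_map_def by blast
next
  case (const c)
  then show ?case using poly_funs.const[of c X] by (intro bexI[of _ "\<lambda>_. c"]) simp_all
next
  case (add f g)
  then obtain p q where "p \<in> poly_funs X" "q \<in> poly_funs X"
    "\<forall>v\<in>V. f (\<phi> v) = p v" "\<forall>v\<in>V. g (\<phi> v) = q v" by blast
  then show ?case using poly_funs.add[of p X q] by (intro bexI[of _ "\<lambda>a. p a + q a"]) auto
next
  case (mult f g)
  then obtain p q where "p \<in> poly_funs X" "q \<in> poly_funs X"
    "\<forall>v\<in>V. f (\<phi> v) = p v" "\<forall>v\<in>V. g (\<phi> v) = q v" by blast
  then show ?case using poly_funs.mult[of p X q] by (intro bexI[of _ "\<lambda>a. p a * q a"]) auto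
qed

lemma zariski_closureD:
  assumes "v \<in> zariski_closure X V S" "f \<in> poly_funs X" "\<And>s. s \<in> S \<Longrightarrow> f s = 0"
  shows "f v = 0"
  using assms unfolding zariski_closure_def by simp

text \<open>
  Continuity of polynomial maps: a polynomial function that vanishes on \<open>\<phi> ` S\<close> pulls back to one that
  vanishes on \<open>S\<close>.
\<close>

lemma zariski_closure_image:
  assumes r: "regular_map X V Y \<phi>" and im: "\<And>v. v \<in> V \<Longrightarrow> \<phi> v \<in> W" and S: "S \<subseteq> V"
    and v: "v \<in> zariski_closure X V S"
  shows "\<phi> v \<in> zariski_closure Y W (\<phi> ` S)"
  unfolding zariski_closure_def
proof (intro CollectI conjI ballI impI)
  have vV: "v \<in> V" using v unfolding zariski_closure_def by blast
  then show "\<phi> v \<in> W" by (rule im)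
  fix f assume "f \<in> poly_funs Y" and z: "\<forall>s\<in>\<phi> ` S. f s = 0"
  then obtain p where p: "p \<in> poly_funs X" "\<forall>v\<in>V. f (\<phi> v) = p v"
    using regular_map_pullback[OF r] by blast
  then have "\<forall>s\<in>S. p s = 0" using z S by (metis imageI subsetD)
  then have "p v = 0" using v p(1) unfolding zariski_closure_def by blast
  then show "f (\<phi> v) = 0" using p(2) vV by simp
qed

lemma zariski_closure_subset: "zariski_closure X V S \<subseteq> V"
  unfolding zariski_closure_def by blast

lemma subset_zariski_closure: "S \<subseteq> V \<Longrightarrow> S \<subseteq> zariski_closure X V S"
  unfolding zariski_closure_def by blast

lemma zariski_closure_mono: "S \<subseteq> T \<Longrightarrow> zariski_closure X V S \<subseteq> zariski_closure X V T"
  unfolding zariski_closure_def by blast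

lemma zariski_closure_least:
  "S \<subseteq> zariski_closure X V T \<Longrightarrow> zariski_closure X V S \<subseteq> zariski_closure X V T"
  unfolding zariski_closure_def by blast

lemma zariski_closure_involution:
  assumes r: "regular_map X V X \<phi>" and im: "\<And>v. v \<in> V \<Longrightarrow> \<phi> v \<in> V"
    and inv: "\<And>v. v \<in> V \<Longrightarrow> \<phi> (\<phi> v) = v" and S: "S \<subseteq> V"
  shows "zariski_closure X V (\<phi> ` S) = \<phi> ` zariski_closure X V S"
proof
  have id: "\<phi> ` \<phi> ` T = T" if "T \<subseteq> V" for T
  proof -
    have "\<phi> ` \<phi> ` T = (\<lambda>v. v) ` T" unfolding image_image by (rule image_cong) (use inv that in auto)
    then show ?thesis by simp
  qed
  have le: "\<phi> ` zariski_closure X V T \<subseteq> zariski_closure X V (\<phi> ` T)" if "T \<subseteq> V" for T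
    using zariski_closure_image[OF r im that] by blast
  show "\<phi> ` zariski_closure X V S \<subseteq> zariski_closure X V (\<phi> ` S)" by (rule le[OF S])
  have "\<phi> ` S \<subseteq> V" using S im by blast
  from image_mono[OF le[OF this], of \<phi>]
  show "zariski_closure X V (\<phi> ` S) \<subseteq> \<phi> ` zariski_closure X V S"
    unfolding id[OF zariski_closure_subset] id[OF S] .
qed

abbreviation pair_coords :: "nat \<Rightarrow> (complex mat \<times> complex mat \<Rightarrow> complex) set" where
  "pair_coords m \<equiv> (\<lambda>f. f \<circ> fst) ` mat_coords m \<union> (\<lambda>f. f \<circ> snd) ` mat_coords m"

abbreviation regular_mat ::
  "('a \<Rightarrow> complex) set \<Rightarrow> 'a set \<Rightarrow> nat \<Rightarrow> ('a \<Rightarrow> complex mat) \<Rightarrow> bool" where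
  "regular_mat X V m \<equiv> regular_map X V (mat_coords m)"

lemma regular_mat_iff:
  "regular_mat X V m \<phi> \<longleftrightarrow>
    (\<forall>i < m. \<forall>j < m. \<exists>p \<in> poly_funs X. \<forall>v \<in> V. \<phi> v $$ (i, j) = p v)"
proof (intro iffI allI impI)
  fix i j assume "regular_mat X V m \<phi>" "i < m" "j < m"
  moreover from this have "(\<lambda>x. x $$ (i, j)) \<in> mat_coords m" unfolding mat_coords_def by blast
  ultimately show "\<exists>p \<in> poly_funs X. \<forall>v \<in> V. \<phi> v $$ (i, j) = p v"
    unfolding regular_map_def by (auto dest: bspec[of _ _ "\<lambda>x. x $$ (i, j)"])
next
  assume r: "\<forall>i < m. \<forall>j < m. \<exists>p \<in> poly_funs X. \<forall>v \<in> V. \<phi> v $$ (i, j) = p v"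
  show "regular_mat X V m \<phi>" unfolding regular_map_def
  proof
    fix y :: "complex mat \<Rightarrow> complex" assume "y \<in> mat_coords m"
    then obtain i j where "i < m" "j < m" "y = (\<lambda>x. x $$ (i, j))" unfolding mat_coords_def by blast
    then show "\<exists>p \<in> poly_funs X. \<forall>v \<in> V. y (\<phi> v) = p v" using r by simp
  qed
qed

lemma regular_pair:
  assumes "regular_mat X V m \<phi>" "regular_mat X V m \<psi>"
  shows "regular_map X V (pair_coords m) (\<lambda>v. (\<phi> v, \<psi> v))"
  using assms unfolding regular_map_def by (auto simp: o_def)

lemma regular_mat_id: "regular_mat (mat_coords m) V m (\<lambda>x. x)"
  unfolding regular_map_def using poly_funs.coord by blast

lemma regular_mat_fst: "regular_mat (pair_coords m) V m fst"
  unfolding regular_map_def using poly_funs.coord by (metis Un_iff comp_apply image_eqI)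

lemma regular_mat_snd: "regular_mat (pair_coords m) V m snd"
  unfolding regular_map_def using poly_funs.coord by (metis Un_iff comp_apply image_eqI)

lemma regular_mat_const: "regular_mat X V m (\<lambda>_. c)"
  unfolding regular_mat_iff
proof (intro allI impI)
  fix i j
  show "\<exists>p \<in> poly_funs X. \<forall>v \<in> V. c $$ (i, j) = p v"
    using poly_funs.const[of "c $$ (i, j)" X] by (intro bexI[of _ "\<lambda>_. c $$ (i, j)"]) simp_all
qed

lemma regular_matD:
  assumes "regular_mat X V m \<phi>" "i < m" "j < m"
  shows "\<exists>p \<in> poly_funs X. \<forall>v \<in> V. \<phi> v $$ (i, j) = p v"
  using assms unfolding regular_mat_iff by simp

lemma poly_funs_sum:
  assumes "finite A" "\<And>c. c \<in> A \<Longrightarrow> p c \<in> poly_funs X"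
  shows "(\<lambda>v. \<Sum>c\<in>A. p c v) \<in> poly_funs X"
  using assms by (induction A rule: finite_induct) (auto intro: poly_funs.const poly_funs.add)

lemma regular_mat_mult:
  assumes r: "regular_mat X V m \<phi>" "regular_mat X V m \<psi>"
    and c: "\<And>v. v \<in> V \<Longrightarrow> \<phi> v \<in> carrier_mat m m" "\<And>v. v \<in> V \<Longrightarrow> \<psi> v \<in> carrier_mat m m"
  shows "regular_mat X V m (\<lambda>v. \<phi> v * \<psi> v)"
  unfolding regular_mat_iff
proof (intro allI impI)
  fix i j assume i: "i < m" and j: "j < m"
  have "\<exists>p. p \<in> poly_funs X \<and> (\<forall>v\<in>V. \<phi> v $$ (i, c) = p v)" if "c < m" for c
    using r(1) i that unfolding regular_mat_iff by blast
  then obtain p where p: "\<And>c. c < m \<Longrightarrow> p c \<in> poly_funs X"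
    "\<And>c v. c < m \<Longrightarrow> v \<in> V \<Longrightarrow> \<phi> v $$ (i, c) = p c v" by metis
  have "\<exists>q. q \<in> poly_funs X \<and> (\<forall>v\<in>V. \<psi> v $$ (c, j) = q v)" if "c < m" for c
    using r(2) j that unfolding regular_mat_iff by blast
  then obtain q where q: "\<And>c. c < m \<Longrightarrow> q c \<in> poly_funs X"
    "\<And>c v. c < m \<Longrightarrow> v \<in> V \<Longrightarrow> \<psi> v $$ (c, j) = q c v" by metis
  show "\<exists>p \<in> poly_funs X. \<forall>v \<in> V. (\<phi> v * \<psi> v) $$ (i, j) = p v"
  proof (intro bexI ballI)
    show "(\<lambda>v. \<Sum>c\<in>{0..<m}. p c v * q c v) \<in> poly_funs X"
      using p(1) q(1) by (intro poly_funs_sum poly_funs.mult) auto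
    fix v assume v: "v \<in> V"
    show "(\<phi> v * \<psi> v) $$ (i, j) = (\<Sum>c\<in>{0..<m}. p c v * q c v)"
      unfolding index_mult_carrier[OF c(1)[OF v] c(2)[OF v] i j]
      by (rule sum.cong) (use p(2) q(2) v in auto)
  qed
qed

lemma regular_mat_uminus:
  assumes r: "regular_mat X V m \<phi>" and c: "\<And>v. v \<in> V \<Longrightarrow> \<phi> v \<in> carrier_mat m m"
  shows "regular_mat X V m (\<lambda>v. - \<phi> v)"
  unfolding regular_mat_iff
proof (intro allI impI)
  fix i j assume i: "i < m" and j: "j < m"
  then obtain p where p: "p \<in> poly_funs X" "\<forall>v \<in> V. \<phi> v $$ (i, j) = p v"
    using r unfolding regular_mat_iff by blast
  show "\<exists>p \<in> poly_funs X. \<forall>v \<in> V. (- \<phi> v) $$ (i, j) = p v"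
  proof (intro bexI ballI)
    show "(\<lambda>v. (- 1) * p v) \<in> poly_funs X" using p(1) by (intro poly_funs.mult poly_funs.const)
    show "(- \<phi> v) $$ (i, j) = (- 1) * p v" if "v \<in> V" for v
      using c[OF that] p(2) that i j by simp
  qed
qed

lemma regular_mat_Ad:
  assumes g: "g \<in> GL m" and r: "regular_mat X V m \<phi>"
    and c: "\<And>v. v \<in> V \<Longrightarrow> \<phi> v \<in> carrier_mat m m"
  shows "regular_mat X V m (\<lambda>v. Ad g (\<phi> v))"
  unfolding Ad_def
  using c GL_carrier[OF g] minv_props(1)[OF g]
  by (intro regular_mat_mult regular_mat_const r) auto

text \<open>
  The block diagonal embedding is a closed immersion: the entries outside the diagonal blocks vanish
  on the image, hence on its closure, and reading off the two blocks is a polynomial retraction.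
\<close>

lemma closure1_block_diag_image:
  assumes S: "S \<subseteq> carrier_mat n n \<times> carrier_mat n n"
  shows "closure1 (n + n) ((\<lambda>(x, y). block_diag x y) ` S) = (\<lambda>(x, y). block_diag x y) ` closure2 n S"
    (is "closure1 _ (?\<phi> ` S) = _")
proof
  let ?V = "carrier_mat n n \<times> carrier_mat n n :: (complex mat \<times> complex mat) set"
  let ?W = "carrier_mat (n + n) (n + n) :: complex mat set"
  have \<phi>W: "?\<phi> v \<in> ?W" if "v \<in> ?V" for v
    using that block_diag_carrier by auto
  have reg: "regular_mat (pair_coords n) ?V (n + n) ?\<phi>"
    unfolding regular_mat_iff
  proof (intro allI impI)
    fix i j assume ij: "i < n + n" "j < n + n"
    have ent: "?\<phi> v $$ (i, j) = (if i < n then if j < n then fst v $$ (i, j) else 0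
        else if j < n then 0 else snd v $$ (i - n, j - n))" if "v \<in> ?V" for v
      using that ij by (auto simp: block_diag_index)
    consider "i < n" "j < n" | "\<not> i < n" "\<not> j < n" | "(i < n) \<noteq> (j < n)" by blast
    then show "\<exists>p \<in> poly_funs (pair_coords n). \<forall>v \<in> ?V. ?\<phi> v $$ (i, j) = p v"
    proof cases
      case 1
      from regular_matD[OF regular_mat_fst this, of ?V]
      show ?thesis using 1 by (simp add: ent cong: ball_cong)
    next
      case 2
      then have "i - n < n" "j - n < n" using ij by auto
      from regular_matD[OF regular_mat_snd this, of ?V]
      show ?thesis using 2 by (simp add: ent cong: ball_cong)
    next
      case 3
      then have "\<forall>v\<in>?V. ?\<phi> v $$ (i, j) = 0" using ent by auto
      then show ?thesis
        using poly_funs.const[of 0 "pair_coords n"] by (intro bexI[of _ "\<lambda>_. 0"]) simp_all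
    qed
  qed
  show "?\<phi> ` closure2 n S \<subseteq> closure1 (n + n) (?\<phi> ` S)"
    unfolding closure1_def closure2_def
    using zariski_closure_image[OF reg \<phi>W S] by blast
  show "closure1 (n + n) (?\<phi> ` S) \<subseteq> ?\<phi> ` closure2 n S"
  proof
    fix z assume z: "z \<in> closure1 (n + n) (?\<phi> ` S)"
    have zc: "z \<in> ?W" using z unfolding closure1_def zariski_closure_def by blast
    have off: "z $$ (i, j) = 0" if ij: "i < n + n" "j < n + n" "\<not> same_block n i j" for i j
    proof -
      have "(\<lambda>x. x $$ (i, j)) \<in> poly_funs (mat_coords (n + n))"
        using ij by (intro poly_funs.coord) (auto simp: mat_coords_def)
      moreover have "s $$ (i, j) = 0" if "s \<in> ?\<phi> ` S" for s
        using that ij S by (auto simp: block_diag_index[where n = n] same_block_def)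
      ultimately show ?thesis by (rule zariski_closureD[OF z[unfolded closure1_def]])
    qed
    let ?\<psi> = "\<lambda>x. (upper_left n x, lower_right n x)"
    have "z \<in> K_lie n" unfolding K_lie_pattern pattern_mats_def using zc off by blast
    then obtain x y where xy: "x \<in> carrier_mat n n" "y \<in> carrier_mat n n" "z = block_diag x y"
      unfolding K_lie_def block_diags_def by blast
    have reg': "regular_map (mat_coords (n + n)) ?W (pair_coords n) ?\<psi>"
    proof (rule regular_pair)
      show "regular_mat (mat_coords (n + n)) ?W n (upper_left n)"
        "regular_mat (mat_coords (n + n)) ?W n (lower_right n)"
        unfolding regular_mat_iff
      proof (safe)
        fix i j assume ij: "i < n" "j < n"
        then have *: "i < n + n" "j < n + n" "i + n < n + n" "j + n < n + n" by auto
        show "\<exists>p\<in>poly_funs (mat_coords (n + n)). \<forall>v\<in>?W. upper_left n v $$ (i, j) = p v"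
          using regular_matD[OF regular_mat_id *(1,2), of ?W] ij unfolding upper_left_def by simp
        show "\<exists>p\<in>poly_funs (mat_coords (n + n)). \<forall>v\<in>?W. lower_right n v $$ (i, j) = p v"
          using regular_matD[OF regular_mat_id *(3,4), of ?W] ij unfolding lower_right_def by simp
      qed
    qed
    have "?\<phi> ` S \<subseteq> ?W" using S \<phi>W by blast
    moreover have "?\<psi> v \<in> ?V" for v by simp
    ultimately have "?\<psi> z \<in> closure2 n (?\<psi> ` ?\<phi> ` S)"
      using zariski_closure_image[OF reg'] z unfolding closure1_def closure2_def by blast
    moreover have "?\<psi> ` ?\<phi> ` S = (\<lambda>v. v) ` S"
      unfolding image_image by (rule image_cong) (use S in \<open>auto simp: blocks_block_diag\<close>)
    moreover have "?\<psi> z = (x, y)" unfolding xy(3) using blocks_block_diag[OF xy(1,2)] by simp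
    ultimately have "(x, y) \<in> closure2 n S" by simp
    then show "z \<in> ?\<phi> ` closure2 n S" by (rule image_eqI[rotated]) (simp add: xy(3))
  qed
qed

text \<open>
  Scaling a Jordan block by \<open>- 1\<close> gives a matrix similar to the Jordan block of the same size with the
  negative eigenvalue.
\<close>

lemma nilp_orbit_uminus:
  assumes x: "x \<in> nilp_orbit n l"
  shows "- x \<in> nilp_orbit n l"
proof -
  have xc: "x \<in> carrier_mat n n" using x unfolding nilp_orbit_def by blast
  have neg: "- x = (- 1) \<cdot>\<^sub>m x" by (rule eq_matI) auto
  obtain k where k: "x ^\<^sub>m k = 0\<^sub>m n n"
    using x xc unfolding nilp_orbit_def nilpotent_mat_def by auto
  have "(- x) ^\<^sub>m k = (- 1) ^ k \<cdot>\<^sub>m x ^\<^sub>m k" for k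
  proof (induction k)
    case 0
    then show ?case by (intro eq_matI) auto
  next
    case (Suc k)
    have P: "x ^\<^sub>m k \<in> carrier_mat n n" using xc by simp
    have dims: "dim_col (x ^\<^sub>m k) = dim_row x" using P xc by simp
    have pc: "x ^\<^sub>m k * x \<in> carrier_mat n n" by (rule mult_carrier_mat[OF P xc])
    show ?case
      unfolding pow_mat.simps(2) Suc mult_smult_assoc_mat[OF P uminus_carrier_mat[OF xc]]
        uminus_mult_right_mat[OF dims]
      by (rule eq_matI) (use pc in \<open>auto simp del: index_mult_mat(1)\<close>)
  qed
  from this[of k] k have nil: "nilpotent_mat (- x)" unfolding nilpotent_mat_def using xc by auto
  obtain n_as where j: "jordan_nf x n_as" "mset (map fst n_as) = l"
    using x unfolding nilp_orbit_def by blast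
  let ?m = "map (\<lambda>(n, a). (n, (- 1) * a)) n_as"
  have "similar_mat ((- 1) \<cdot>\<^sub>m x) ((- 1) \<cdot>\<^sub>m jordan_matrix n_as)"
    using j(1) unfolding jordan_nf_def by (intro similar_mat_smult) simp
  moreover have "similar_mat ((- 1) \<cdot>\<^sub>m jordan_matrix n_as) (jordan_matrix ?m)"
    by (rule similar_mat_jordan_matrix_smult) simp
  ultimately have "similar_mat (- x) (jordan_matrix ?m)" unfolding neg by (rule similar_mat_trans)
  moreover have fst: "map fst ?m = map fst n_as" by (auto simp: case_prod_beta)
  then have "fst ` set ?m = fst ` set n_as" by (metis set_map)
  ultimately have "jordan_nf (- x) ?m" using j(1) unfolding jordan_nf_def by simp
  moreover have "mset (map fst ?m) = l" unfolding fst by (rule j(2))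
  ultimately have "\<exists>n_as. jordan_nf (- x) n_as \<and> mset (map fst n_as) = l" by blast
  then show ?thesis unfolding nilp_orbit_def using xc nil by simp
qed

lemma closure_nilp_orbit_uminus:
  assumes "x \<in> closure1 n (nilp_orbit n l)"
  shows "- x \<in> closure1 n (nilp_orbit n l)"
proof -
  have "- x \<in> closure1 n (uminus ` nilp_orbit n l)"
    unfolding closure1_def
  proof (rule zariski_closure_image[where \<phi> = uminus])
    show "regular_mat (mat_coords n) (carrier_mat n n) n uminus"
      by (rule regular_mat_uminus[OF regular_mat_id])
    show "nilp_orbit n l \<subseteq> carrier_mat n n" unfolding nilp_orbit_def by blast
  qed (use assms in \<open>auto simp: closure1_def\<close>)
  moreover have "uminus ` nilp_orbit n l \<subseteq> nilp_orbit n l" using nilp_orbit_uminus by blast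
  ultimately show ?thesis
    using zariski_closure_mono unfolding closure1_def by blast
qed

section \<open>The pairs of products attached to the Steinberg map\<close>

text \<open>
  Column by column: once the entries of the inverse below the diagonal vanish in all columns before
  \<open>j\<close>, the equation \<open>b\<^sup>-\<^sup>1 b = 1\<close> in column \<open>j\<close>, on and below the diagonal, involves only the product
  of an entry of \<open>b\<^sup>-\<^sup>1\<close> with \<open>b\<^sub>j\<^sub>j\<close>. The diagonal case shows that \<open>b\<^sub>j\<^sub>j\<close> is not \<open>0\<close>.
\<close>

lemma minv_upper_triangular:
  assumes b: "b \<in> Borel n"
  shows "minv b \<in> pattern_mats n (\<le>)"
proof -
  have G: "b \<in> GL n" and bu: "b \<in> pattern_mats n (\<le>)"
    using b unfolding Borel_def upper_triangular_pattern by auto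
  note P = minv_props[OF G] and B = pattern_matsD[OF bu]
  have "\<forall>i < n. j < i \<longrightarrow> minv b $$ (i, j) = 0" if "j < n" for j
    using that
  proof (induction j rule: less_induct)
    case (less j)
    have key: "(1\<^sub>m n :: complex mat) $$ (i, j) = minv b $$ (i, j) * b $$ (j, j)" if i: "i < n" "j \<le> i" for i
    proof -
      have "(1\<^sub>m n :: complex mat) $$ (i, j) = (\<Sum>c \<in> {0..<n}. minv b $$ (i, c) * b $$ (c, j))"
        using index_mult_carrier[OF P(1) B(1) i(1) less.prems] P(3) by simp
      also have "\<dots> = (\<Sum>c \<in> {0..<n}. if c = j then minv b $$ (i, j) * b $$ (j, j) else 0)"
      proof (rule sum.cong)
        fix c assume c: "c \<in> {0..<n}"
        show "minv b $$ (i, c) * b $$ (c, j) = (if c = j then minv b $$ (i, j) * b $$ (j, j) else 0)"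
        proof (cases "c < j")
          case True
          then have "minv b $$ (i, c) = 0" using less.IH[of c] less.prems i by simp
          then show ?thesis using True by simp
        next
          case False
          then show ?thesis using B(2)[of c j] c less.prems by auto
        qed
      qed simp
      finally show ?thesis using less.prems by simp
    qed
    have "b $$ (j, j) \<noteq> 0" using key[of j] less.prems by auto
    then show ?case using key by (metis index_one_mat(1) less.prems less_imp_le_nat mult_eq_0_iff order_less_irrefl)
  qed
  then show ?thesis unfolding pattern_mats_def using P(1) by (simp add: not_le)
qed

text \<open>
  This is the saturation of the image, under \<open>(x, y) \<mapsto> (x y, y x)\<close>, of the fibre of the conormal
  variety over the single point \<open>t\<close>.
\<close>

definition conormal_fibre_saturation :: "nat \<Rightarrow> complex mat \<Rightarrow> (complex mat \<times> complex mat) set" where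
  "conormal_fibre_saturation n t = {(Ad g (t * a), Ad h (a * t)) | g h a. g \<in> GL n \<and> h \<in> GL n \<and>
     a \<in> carrier_mat n n \<and> t * a \<in> strictly_upper_mats n \<and> a * t \<in> strictly_upper_mats n}"

lemma conormal_fibre_saturation_carrier:
  assumes "t \<in> carrier_mat n n"
  shows "conormal_fibre_saturation n t \<subseteq> carrier_mat n n \<times> carrier_mat n n"
proof
  fix v assume "v \<in> conormal_fibre_saturation n t"
  then obtain g h a where "g \<in> GL n" "h \<in> GL n" "a \<in> carrier_mat n n"
    "v = (Ad g (t * a), Ad h (a * t))" unfolding conormal_fibre_saturation_def by blast
  moreover have "t * a \<in> carrier_mat n n" "a * t \<in> carrier_mat n n"
    using assms \<open>a \<in> carrier_mat n n\<close> by auto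
  ultimately show "v \<in> carrier_mat n n \<times> carrier_mat n n" using Ad_carrier by auto
qed

lemma one_GL: "1\<^sub>m n \<in> GL n"
  by (rule GL_I[of _ _ "1\<^sub>m n"]) auto

text \<open>
  With \<open>a = b\<^sub>2 y b\<^sub>1\<close> the products \<open>t a\<close> and \<open>a t\<close> are conjugate to \<open>x y\<close> and \<open>y x\<close> by elements of the
  Borel group, and such conjugations preserve strict upper triangularity.
\<close>

lemma open_part_in_conormal_fibre_saturation:
  assumes t: "t \<in> carrier_mat n n" and xy: "(x, y) \<in> conormal_mat n"
    and x: "x = b1 * t * b2" and b: "b1 \<in> Borel n" "b2 \<in> Borel n"
    and g: "g \<in> GL n" and h: "h \<in> GL n"
  shows "(Ad g (x * y), Ad h (y * x)) \<in> conormal_fibre_saturation n t"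
proof -
  have B: "b1 \<in> GL n" "b2 \<in> GL n" "b1 \<in> pattern_mats n (\<le>)" "b2 \<in> pattern_mats n (\<le>)"
    using b unfolding Borel_def upper_triangular_pattern by auto
  note c1 = GL_carrier[OF B(1)] minv_props[OF B(1)]
  note c2 = GL_carrier[OF B(2)] minv_props[OF B(2)]
  have yc: "y \<in> carrier_mat n n" and xc: "x \<in> carrier_mat n n"
    and N: "x * y \<in> pattern_mats n (<)" "y * x \<in> pattern_mats n (<)"
    using xy unfolding conormal_mat_def strictly_upper_pattern by auto
  define a where "a = b2 * y * b1"
  have ac: "a \<in> carrier_mat n n" unfolding a_def using c1 c2 yc by auto
  have tac: "t * a \<in> carrier_mat n n" "a * t \<in> carrier_mat n n" using ac t by auto
  have 1: "Ad b1 (t * a) = x * y"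
  proof -
    have "Ad b1 (t * a) = (b1 * t * b2 * y * b1) * minv b1"
      unfolding Ad_def a_def using t yc c1 c2 by (simp add: assoc_mult_mat[of _ n n _ n _ n])
    also have "\<dots> = (b1 * t * b2 * y) * (b1 * minv b1)"
      using t yc c1 c2 by (intro assoc_mult_mat[of _ n n _ n _ n]) auto
    also have "\<dots> = x * y" unfolding x using c1 c2 t yc by simp
    finally show ?thesis .
  qed
  have 2: "Ad (minv b2) (a * t) = y * x"
  proof -
    have "Ad (minv b2) (a * t) = minv b2 * (b2 * (y * b1 * t * b2))"
      unfolding Ad_def a_def minv_minv[OF B(2)]
      using t yc c1 c2 by (simp add: assoc_mult_mat[of _ n n _ n _ n])
    also have "\<dots> = minv b2 * b2 * (y * b1 * t * b2)"
      using t yc c1 c2 by (intro assoc_mult_mat[of _ n n _ n _ n, symmetric]) auto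
    also have "\<dots> = y * x" unfolding x
      using c1 c2 t yc by (simp add: assoc_mult_mat[of _ n n _ n _ n])
    finally show ?thesis .
  qed
  have "t * a = minv b1 * (x * y) * b1"
    using Ad_image_minv(1)[OF B(1), of "{t * a}"] tac unfolding 1[symmetric]
    by (simp add: Ad_def minv_minv[OF B(1)])
  moreover have "minv b1 * (x * y) * b1 \<in> pattern_mats n (<)"
    by (rule pattern_mats_mult[OF pattern_mats_mult[OF minv_upper_triangular[OF b(1)] N(1), where T = "(<)"] B(3)]) auto
  moreover have "a * t = b2 * (y * x) * minv b2"
    using Ad_minv1[OF B(2) tac(2), unfolded 2] unfolding Ad_def by simp
  moreover have "b2 * (y * x) * minv b2 \<in> pattern_mats n (<)"
    by (rule pattern_mats_mult[OF pattern_mats_mult[OF B(4) N(2), where T = "(<)"] minv_upper_triangular[OF b(2)]]) auto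
  ultimately have "t * a \<in> strictly_upper_mats n" "a * t \<in> strictly_upper_mats n"
    unfolding strictly_upper_pattern by simp_all
  moreover have "Ad g (x * y) = Ad (g * b1) (t * a)"
    using Ad_mult_GL[OF g B(1) tac(1)] 1 by simp
  moreover have "Ad h (y * x) = Ad (h * minv b2) (a * t)"
    using Ad_mult_GL[OF h minv_GL[OF B(2)] tac(2)] 2 by simp
  moreover have "g * b1 \<in> GL n" "h * minv b2 \<in> GL n"
    using GL_mult(1) g h B minv_GL by blast+
  ultimately show ?thesis unfolding conormal_fibre_saturation_def using ac by blast
qed

text \<open>
  For fixed \<open>g\<close> and \<open>h\<close> the map \<open>(x, y) \<mapsto> (g (x y) g\<^sup>-\<^sup>1, h (y x) h\<^sup>-\<^sup>1)\<close> is polynomial, so it sends the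
  closure of the open part into the closure of its image, and that image lies in the saturated fibre.
\<close>

lemma closure_saturation_conormal_comp:
  assumes t: "t \<in> carrier_mat n n"
  shows "closure2 n (GLxGL_saturation n ((\<lambda>(x, y). (x * y, y * x)) ` conormal_comp n t))
    = closure2 n (conormal_fibre_saturation n t)" (is "closure2 n ?A = _")
proof
  let ?C = "{(x, y) \<in> conormal_mat n. x \<in> {b1 * t * b2 | b1 b2. b1 \<in> Borel n \<and> b2 \<in> Borel n}}"
  let ?V = "carrier_mat n n \<times> carrier_mat n n :: (complex mat \<times> complex mat) set"
  have CV: "?C \<subseteq> ?V" unfolding conormal_mat_def by blast
  have "1\<^sub>m n \<in> Borel n" unfolding Borel_def upper_triangular_mats_def upper_triangular_def
    using one_GL by auto
  then have "t \<in> {b1 * t * b2 | b1 b2. b1 \<in> Borel n \<and> b2 \<in> Borel n}"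
    using t by (intro CollectI exI[of _ "1\<^sub>m n"]) simp
  then have ta: "(t, a) \<in> conormal_comp n t"
    if "a \<in> carrier_mat n n" "t * a \<in> strictly_upper_mats n" "a * t \<in> strictly_upper_mats n" for a
    using that t subset_zariski_closure[OF CV, of "pair_coords n"]
    unfolding conormal_comp_def closure2_def by (auto simp: conormal_mat_def)
  have "conormal_fibre_saturation n t \<subseteq> ?A"
  proof
    fix v assume "v \<in> conormal_fibre_saturation n t"
    then obtain g h a where a: "g \<in> GL n" "h \<in> GL n" "a \<in> carrier_mat n n"
      "t * a \<in> strictly_upper_mats n" "a * t \<in> strictly_upper_mats n"
      "v = (Ad g (t * a), Ad h (a * t))" unfolding conormal_fibre_saturation_def by blast
    have "(t * a, a * t) \<in> (\<lambda>(x, y). (x * y, y * x)) ` conormal_comp n t"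
      by (rule image_eqI[OF _ ta[OF a(3-5)]]) simp
    then show "v \<in> ?A" unfolding GLxGL_saturation_def a(6) using a(1,2) by blast
  qed
  then show "closure2 n (conormal_fibre_saturation n t) \<subseteq> closure2 n ?A"
    unfolding closure2_def by (rule zariski_closure_mono)
  have "?A \<subseteq> closure2 n (conormal_fibre_saturation n t)"
  proof
    fix v assume "v \<in> ?A"
    then obtain g h x y where gh: "g \<in> GL n" "h \<in> GL n" and xy: "(x, y) \<in> conormal_comp n t"
      and v: "v = (Ad g (x * y), Ad h (y * x))" unfolding GLxGL_saturation_def by auto
    let ?\<phi> = "\<lambda>p. (Ad g (fst p * snd p), Ad h (snd p * fst p))"
    have prod: "fst p * snd p \<in> carrier_mat n n" "snd p * fst p \<in> carrier_mat n n" if "p \<in> ?V" for p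
      using that by auto
    have reg: "regular_map (pair_coords n) ?V (pair_coords n) ?\<phi>"
      by (intro regular_pair regular_mat_Ad gh regular_mat_mult regular_mat_fst regular_mat_snd)
        (auto intro: prod)
    have im: "?\<phi> p \<in> ?V" if "p \<in> ?V" for p
      using prod[OF that] Ad_carrier[OF gh(1)] Ad_carrier[OF gh(2)] by simp
    have "(x, y) \<in> zariski_closure (pair_coords n) ?V ?C"
      using xy unfolding conormal_comp_def closure2_def .
    from zariski_closure_image[OF reg im CV this]
    have "?\<phi> (x, y) \<in> zariski_closure (pair_coords n) ?V (?\<phi> ` ?C)" .
    moreover have "?\<phi> ` ?C \<subseteq> conormal_fibre_saturation n t"
    proof
      fix w assume "w \<in> ?\<phi> ` ?C"
      then obtain x y b1 b2 where "(x, y) \<in> conormal_mat n" "x = b1 * t * b2" "b1 \<in> Borel n"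
        "b2 \<in> Borel n" "w = (Ad g (x * y), Ad h (y * x))" by auto
      then show "w \<in> conormal_fibre_saturation n t"
        using open_part_in_conormal_fibre_saturation[OF t _ _ _ _ gh] by simp
    qed
    then have "zariski_closure (pair_coords n) ?V (?\<phi> ` ?C) \<subseteq> closure2 n (conormal_fibre_saturation n t)"
      unfolding closure2_def by (rule zariski_closure_mono)
    ultimately show "v \<in> closure2 n (conormal_fibre_saturation n t)" unfolding v by auto
  qed
  then show "closure2 n ?A \<subseteq> closure2 n (conormal_fibre_saturation n t)"
    unfolding closure2_def by (rule zariski_closure_least)
qed

section \<open>The image of the conormal bundle\<close>

text \<open>
  The matrix \<open>g\<close> sends \<open>(v, 0)\<close> to \<open>(t v, v)\<close>, so it carries \<open>\<complex>\<^sup>n \<oplus> 0\<close> to the graph that is the image of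
  \<open>t @\<^sub>r 1\<^sub>m n\<close>. Its inverse has the blocks \<open>0, 1, 1, - t\<close>; conjugating a matrix whose only nonzero
  block is \<open>a\<close> in the upper right corner gives the blocks \<open>t a, - t a t, a, - a t\<close>.
\<close>

lemma graph_subspace_transporter:
  fixes t :: "complex mat"
  assumes t: "t \<in> carrier_mat n n"
  defines "g \<equiv> four_block_mat t (1\<^sub>m n) (1\<^sub>m n) (0\<^sub>m n n)"
  shows "g \<in> GL (n + n)"
    and "stabilizer_algebra (n + n) (mat_image (t @\<^sub>r 1\<^sub>m n)) = Ad g ` PS_lie n"
    and "\<And>a. a \<in> carrier_mat n n \<Longrightarrow>
      theta_part n (Ad g (four_block_mat (0\<^sub>m n n) a (0\<^sub>m n n) (0\<^sub>m n n)))
        = block_diag (t * a) (- (a * t))"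
proof -
  define h where "h = four_block_mat (0\<^sub>m n n) (1\<^sub>m n) (1\<^sub>m n) (- t)"
  have gc: "g \<in> carrier_mat (n + n) (n + n)" and hc: "h \<in> carrier_mat (n + n) (n + n)"
    unfolding g_def h_def using t by auto
  have "t + - t = 0\<^sub>m n n"
    "1\<^sub>m n + - 0\<^sub>m n n = (1\<^sub>m n :: complex mat)" using t by (auto intro!: eq_matI)
  then have gh: "g * h = 1\<^sub>m (n + n)" "h * g = 1\<^sub>m (n + n)"
    unfolding g_def h_def using t
    by (simp_all add: mult_four_block_mat[of _ n n _ n _ n _ _ n _ n])
  show G: "g \<in> GL (n + n)" using GL_I[OF gc hc gh] .
  have inv: "minv g = h" using minv_unique[OF gc hc gh] .
  let ?W = "{v @\<^sub>v 0\<^sub>v n | v. v \<in> carrier_vec n} :: complex vec set"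
  have gw: "g *\<^sub>v (v @\<^sub>v 0\<^sub>v n) = (t @\<^sub>r 1\<^sub>m n) *\<^sub>v v" if v: "v \<in> carrier_vec n" for v
  proof -
    have z: "(1\<^sub>m n :: complex mat) *\<^sub>v 0\<^sub>v n = 0\<^sub>v n" "(0\<^sub>m n n :: complex mat) *\<^sub>v 0\<^sub>v n = 0\<^sub>v n"
      by auto
    have "g *\<^sub>v (v @\<^sub>v 0\<^sub>v n) = (t *\<^sub>v v) @\<^sub>v v"
      unfolding g_def
      using four_block_mat_mult_vec[of t n n "1\<^sub>m n" n "1\<^sub>m n" n "0\<^sub>m n n" v "0\<^sub>v n"] t v z by simp
    then show ?thesis using mat_mult_append[OF t one_carrier_mat v] v by simp
  qed
  have "dim_col (t @\<^sub>r 1\<^sub>m n) = n" using carrier_append_rows[OF t one_carrier_mat[of n]]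
    by (rule carrier_matD(2))
  then have "mat_image (t @\<^sub>r 1\<^sub>m n) = (\<lambda>v. (t @\<^sub>r 1\<^sub>m n) *\<^sub>v v) ` carrier_vec n"
    unfolding mat_image_def by auto
  also have "\<dots> = (\<lambda>v. g *\<^sub>v (v @\<^sub>v 0\<^sub>v n)) ` carrier_vec n"
    by (rule image_cong) (simp_all add: gw)
  also have "\<dots> = (\<lambda>w. g *\<^sub>v w) ` ?W" by auto
  finally have im: "mat_image (t @\<^sub>r 1\<^sub>m n) = (\<lambda>w. g *\<^sub>v w) ` ?W" .
  have "?W \<subseteq> carrier_vec (n + n)" by auto
  then show "stabilizer_algebra (n + n) (mat_image (t @\<^sub>r 1\<^sub>m n)) = Ad g ` PS_lie n"
    unfolding PS_lie_def im by (rule stabilizer_algebra_image[OF G])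
  fix a :: "complex mat" assume a: "a \<in> carrier_mat n n"
  have ga: "g * four_block_mat (0\<^sub>m n n) a (0\<^sub>m n n) (0\<^sub>m n n)
      = four_block_mat (0\<^sub>m n n) (t * a) (0\<^sub>m n n) a"
    unfolding g_def using t a by (simp add: mult_four_block_mat[of _ n n _ n _ n _ _ n _ n])
  have ta: "t * a \<in> carrier_mat n n" using t a by simp
  have "Ad g (four_block_mat (0\<^sub>m n n) a (0\<^sub>m n n) (0\<^sub>m n n))
      = four_block_mat (t * a) (t * a * - t) a (a * - t)"
    unfolding Ad_def inv ga h_def using t a ta
    by (simp add: mult_four_block_mat[of _ n n _ n _ n _ _ n _ n])
  moreover have "four_block_mat (t * a) (t * a * - t) a (a * - t) \<in> carrier_mat (n + n) (n + n)"
    "a * - t = - (a * t)" "t * a * - t \<in> carrier_mat n n" "- (a * t) \<in> carrier_mat n n"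
    using t a ta by auto
  ultimately show "theta_part n (Ad g (four_block_mat (0\<^sub>m n n) a (0\<^sub>m n n) (0\<^sub>m n n)))
      = block_diag (t * a) (- (a * t))"
    using a ta by (simp add: theta_part_eq)
qed

lemma strictly_upper_uminus:
  "x \<in> carrier_mat n n \<Longrightarrow> - x \<in> strictly_upper_mats n \<longleftrightarrow> x \<in> strictly_upper_mats n"
  unfolding strictly_upper_mats_def by auto

text \<open>
  The conormal bundle is cut out inside the conormal variety of the double flag variety, so the pairs
  in the orbit have to be recognized as a Borel and a parabolic subalgebra.
\<close>

lemma flag_orbit_double_flag:
  assumes t: "t \<in> carrier_mat n n"
  shows "flag_orbit n (t @\<^sub>r 1\<^sub>m n) \<subseteq> double_flag_variety n"
proof
  fix p assume "p \<in> flag_orbit n (t @\<^sub>r 1\<^sub>m n)"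
  then obtain k where k: "k \<in> K_group n"
    and p: "p = (Ad k ` BK_lie n, Ad k ` stabilizer_algebra (n + n) (mat_image (t @\<^sub>r 1\<^sub>m n)))"
    unfolding flag_orbit_def by blast
  from k obtain g h where gh: "g \<in> GL n" "h \<in> GL n" "k = block_diag g h"
    unfolding K_group_def block_diags_def by blast
  note kG = block_diag_GL(1)[OF gh(1,2), folded gh(3)]
  define w where "w = four_block_mat t (1\<^sub>m n) (1\<^sub>m n) (0\<^sub>m n n)"
  note W = graph_subspace_transporter[OF t, folded w_def]
  have "K_lie n \<subseteq> carrier_mat (n + n) (n + n)"
    unfolding K_lie_pattern pattern_mats_def by blast
  then have "borel_subalgebra (n + n) (K_lie n) (Ad k ` BK_lie n)"
    using borel_subalgebra_Ad[OF kG borel_subalgebra_BK_lie] Ad_K_lie[OF gh(1,2)] gh(3) by blast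
  moreover have "Ad k ` Ad w ` PS_lie n = Ad (k * w) ` PS_lie n"
    unfolding image_image
    by (rule image_cong) (auto simp: Ad_mult_GL[OF kG W(1)] PS_lie_pattern pattern_mats_def)
  ultimately show "p \<in> double_flag_variety n"
    unfolding p double_flag_variety_def W(2) using GL_mult(1)[OF kG W(1)] by auto
qed

text \<open>
  Nilradicals and diagonal parts commute with conjugation by \<open>K\<close>, so a point of the conormal bundle over
  a translate by \<open>(g, h)\<close> comes from a point over the base pair. There it is the conjugate, by the
  matrix that moves \<open>\<complex>\<^sup>n \<oplus> 0\<close> to the graph, of an element of the nilradical of the standard parabolic
  subalgebra, given by one block \<open>a\<close>; its diagonal part is \<open>(t a, - a t)\<close>.
\<close>

lemma theta_image_conormal_bundle:
  assumes t: "t \<in> carrier_mat n n"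
  shows "(\<lambda>(b, p, x). theta_part n x) ` conormal_bundle n (t @\<^sub>r 1\<^sub>m n)
    = (\<lambda>(x, y). block_diag x y) ` (\<lambda>(u, v). (u, - v)) ` conormal_fibre_saturation n t"
    (is "?L = ?R")
proof -
  define w where "w = four_block_mat t (1\<^sub>m n) (1\<^sub>m n) (0\<^sub>m n n)"
  note W = graph_subspace_transporter[OF t, folded w_def]
  let ?U = "\<lambda>a. four_block_mat (0\<^sub>m n n) a (0\<^sub>m n n) (0\<^sub>m n n) :: complex mat"
  let ?S = "stabilizer_algebra (n + n) (mat_image (t @\<^sub>r 1\<^sub>m n))"
  let ?N = "block_diags (strictly_upper_mats n) (strictly_upper_mats n)"
  have PSc: "PS_lie n \<subseteq> carrier_mat (n + n) (n + n)" and BKc: "BK_lie n \<subseteq> carrier_mat (n + n) (n + n)"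
    unfolding PS_lie_pattern BK_lie_pattern pattern_mats_def by blast+
  have Sc: "?S \<subseteq> carrier_mat (n + n) (n + n)" unfolding stabilizer_algebra_def by blast
  have nilS: "nilradical (n + n) ?S = Ad w ` ?U ` carrier_mat n n"
    unfolding W(2) nilradical_Ad[OF W(1) PSc] nilradical_PS_lie ..
  have Uc: "?U a \<in> carrier_mat (n + n) (n + n)" if "a \<in> carrier_mat n n" for a
    using that by auto
  note AUc = Ad_carrier[OF W(1) Uc]
  have Nmem: "block_diag (t * a) (- (a * t)) \<in> ?N \<longleftrightarrow>
      t * a \<in> strictly_upper_mats n \<and> a * t \<in> strictly_upper_mats n"
    if a: "a \<in> carrier_mat n n" for a
  proof -
    have c: "t * a \<in> carrier_mat n n" "a * t \<in> carrier_mat n n" "- (a * t) \<in> carrier_mat n n"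
      using a t by auto
    have "block_diag (t * a) (- (a * t)) \<in> ?N \<longleftrightarrow>
        t * a \<in> strictly_upper_mats n \<and> - (a * t) \<in> strictly_upper_mats n"
    proof
      assume "block_diag (t * a) (- (a * t)) \<in> ?N"
      then obtain x y where xy: "x \<in> strictly_upper_mats n" "y \<in> strictly_upper_mats n"
        "block_diag (t * a) (- (a * t)) = block_diag x y" unfolding block_diags_def by blast
      have "x \<in> carrier_mat n n" "y \<in> carrier_mat n n"
        using xy(1,2) unfolding strictly_upper_mats_def by auto
      then show "t * a \<in> strictly_upper_mats n \<and> - (a * t) \<in> strictly_upper_mats n"
        using blocks_block_diag[OF c(1,3)] blocks_block_diag[of x n y] xy by simp
    qed (auto simp: block_diags_def)
    then show ?thesis using strictly_upper_uminus[OF c(2)] by simp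
  qed
  have Ad_theta: "theta_part n (Ad (block_diag g h) (Ad w (?U a)))
      = block_diag (Ad g (t * a)) (- Ad h (a * t))"
    if "g \<in> GL n" "h \<in> GL n" and a: "a \<in> carrier_mat n n" for g h a
  proof -
    have c: "t * a \<in> carrier_mat n n" "a * t \<in> carrier_mat n n" "- (a * t) \<in> carrier_mat n n"
      using a t by auto
    show ?thesis unfolding theta_part_Ad[OF that(1,2) AUc[OF a]] W(3)[OF a]
      Ad_block_diag[OF that(1,2) c(1,3)] Ad_uminus[OF that(2) c(2)] ..
  qed
  have theta_nil: "theta_part n (Ad (block_diag g h) (Ad w (?U a))) \<in> nilradical (n + n) (Ad (block_diag g h) ` BK_lie n)
      \<longleftrightarrow> t * a \<in> strictly_upper_mats n \<and> a * t \<in> strictly_upper_mats n"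
    if "g \<in> GL n" "h \<in> GL n" and a: "a \<in> carrier_mat n n" for g h a
  proof -
    let ?k = "block_diag g h" and ?z = "block_diag (t * a) (- (a * t))"
    note kG = block_diag_GL(1)[OF that(1,2)]
    have zc: "?z \<in> carrier_mat (n + n) (n + n)"
      by (rule block_diag_carrier) (use a t in auto)
    have "?N \<subseteq> carrier_mat (n + n) (n + n)"
      using nilradical_carrier[OF BKc] unfolding nilradical_BK_lie .
    then have "?z \<in> ?N" if "Ad ?k ?z \<in> Ad ?k ` ?N"
      using imageI[OF that, of "Ad (minv ?k)"] Ad_image_minv(1)[OF kG, of "{?z}"]
        Ad_image_minv(1)[OF kG, of ?N] zc by simp
    then have "Ad ?k ?z \<in> Ad ?k ` ?N \<longleftrightarrow> ?z \<in> ?N" by (intro iffI imageI)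
    then show ?thesis
      unfolding theta_part_Ad[OF that(1,2) AUc[OF a]] W(3)[OF a] nilradical_Ad[OF kG BKc]
        nilradical_BK_lie Nmem[OF a, symmetric] .
  qed
  show ?thesis
  proof
    show "?L \<subseteq> ?R"
    proof
      fix z assume "z \<in> ?L"
      then obtain b p x where bpx: "(b, p, x) \<in> conormal_flag n" "(b, p) \<in> flag_orbit n (t @\<^sub>r 1\<^sub>m n)"
        and z: "z = theta_part n x" unfolding conormal_bundle_def by auto
      from bpx(2) obtain k where k: "k \<in> K_group n" "b = Ad k ` BK_lie n" "p = Ad k ` ?S"
        unfolding flag_orbit_def by blast
      from k(1) obtain g h where gh: "g \<in> GL n" "h \<in> GL n" "k = block_diag g h"
        unfolding K_group_def block_diags_def by blast
      note kG = block_diag_GL(1)[OF gh(1,2), folded gh(3)]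
      have x: "x \<in> nilradical (n + n) p" "theta_part n x \<in> nilradical (n + n) b"
        using bpx(1) unfolding conormal_flag_def by auto
      have "x \<in> Ad k ` Ad w ` ?U ` carrier_mat n n"
        using x(1) unfolding k(3) nilradical_Ad[OF kG Sc] nilS .
      then obtain a where a: "a \<in> carrier_mat n n" "x = Ad k (Ad w (?U a))" by blast
      have N: "t * a \<in> strictly_upper_mats n" "a * t \<in> strictly_upper_mats n"
        using theta_nil[OF gh(1,2) a(1)] x(2) unfolding k(2) a(2) gh(3) by simp_all
      then have "(Ad g (t * a), Ad h (a * t)) \<in> conormal_fibre_saturation n t"
        unfolding conormal_fibre_saturation_def using gh a by blast
      then have "(\<lambda>(x, y). block_diag x y) ((\<lambda>(u, v). (u, - v)) (Ad g (t * a), Ad h (a * t))) \<in> ?R"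
        by (intro imageI)
      then show "z \<in> ?R" unfolding z a(2) gh(3) Ad_theta[OF gh(1,2) a(1)] by simp
    qed
    show "?R \<subseteq> ?L"
    proof
      fix z assume "z \<in> ?R"
      then obtain g h a where gh: "g \<in> GL n" "h \<in> GL n" and a: "a \<in> carrier_mat n n"
        and N: "t * a \<in> strictly_upper_mats n" "a * t \<in> strictly_upper_mats n"
        and z: "z = block_diag (Ad g (t * a)) (- Ad h (a * t))"
        unfolding conormal_fibre_saturation_def by auto
      let ?k = "block_diag g h"
      let ?x = "Ad ?k (Ad w (?U a))" and ?b = "Ad ?k ` BK_lie n" and ?p = "Ad ?k ` ?S"
      note kG = block_diag_GL(1)[OF gh]
      have "?k \<in> K_group n" unfolding K_group_def block_diags_def using gh by blast
      then have fo: "(?b, ?p) \<in> flag_orbit n (t @\<^sub>r 1\<^sub>m n)" unfolding flag_orbit_def by blast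
      have "?x \<in> nilradical (n + n) ?p"
        unfolding nilradical_Ad[OF kG Sc] nilS using a by blast
      moreover have "theta_part n ?x \<in> nilradical (n + n) ?b" using theta_nil[OF gh a] N by blast
      moreover have "?x \<in> carrier_mat (n + n) (n + n)" by (rule Ad_carrier[OF kG AUc[OF a]])
      ultimately have "(?b, ?p, ?x) \<in> conormal_bundle n (t @\<^sub>r 1\<^sub>m n)"
        unfolding conormal_bundle_def conormal_flag_def
        using fo flag_orbit_double_flag[OF t] by auto
      then have "(\<lambda>(b, p, x). theta_part n x) (?b, ?p, ?x) \<in> ?L" by (rule imageI)
      then show "z \<in> ?L" unfolding z using Ad_theta[OF gh a] by simp
    qed
  qed
qed

section \<open>Equality of the two maps\<close>

theorem theorem9p1:
  fixes n :: nat and \<tau> :: "complex mat"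
  assumes "\<tau> \<in> partial_perms n"
  shows "Xi_k n (\<tau> @\<^sub>r 1\<^sub>m n) = Phi n \<tau>"
proof -
  have t: "\<tau> \<in> carrier_mat n n" using assms unfolding partial_perms_def by blast
  let ?V = "carrier_mat n n \<times> carrier_mat n n :: (complex mat \<times> complex mat) set"
  let ?\<beta> = "\<lambda>(x, y). block_diag x y" and ?\<nu> = "\<lambda>(u, v). (u, - v) :: complex mat \<times> complex mat"
  \<comment> \<open>The embedding \<open>\<beta>\<close> as block diagonal matrices and the sign change \<open>\<nu>\<close> of the second component
    translate the condition on the conormal bundle into one on the closure \<open>C\<close>.\<close>
  define C where "C = closure2 n (conormal_fibre_saturation n \<tau>)"
  have SV: "conormal_fibre_saturation n \<tau> \<subseteq> ?V" by (rule conormal_fibre_saturation_carrier[OF t])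
  have CV: "C \<subseteq> ?V" unfolding C_def closure2_def by (rule zariski_closure_subset)
  have \<nu>V: "?\<nu> v \<in> ?V" if "v \<in> ?V" for v using that by auto
  have \<nu>\<nu>: "?\<nu> (?\<nu> v) = v" if "v \<in> ?V" for v using that by auto
  have reg: "regular_map (pair_coords n) ?V (pair_coords n) ?\<nu>"
  proof -
    have "regular_map (pair_coords n) ?V (pair_coords n) (\<lambda>v. (fst v, - snd v))"
      by (intro regular_pair regular_mat_fst regular_mat_uminus regular_mat_snd) auto
    then show ?thesis by (simp add: case_prod_beta')
  qed
  have "closure2 n (?\<nu> ` conormal_fibre_saturation n \<tau>) = ?\<nu> ` C"
    unfolding C_def closure2_def by (rule zariski_closure_involution[OF reg \<nu>V \<nu>\<nu> SV])
  moreover have "?\<nu> ` conormal_fibre_saturation n \<tau> \<subseteq> ?V" using SV \<nu>V by blast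
  ultimately have Xi: "closure1 (n + n) ((\<lambda>(b, p, x). theta_part n x) ` conormal_bundle n (\<tau> @\<^sub>r 1\<^sub>m n))
      = ?\<beta> ` ?\<nu> ` C"
    unfolding theta_image_conormal_bundle[OF t] using closure1_block_diag_image by simp
  have inj: "inj_on ?\<beta> ?V"
    by (rule inj_on_inverseI[of _ "\<lambda>z. (upper_left n z, lower_right n z)"])
      (auto simp: blocks_block_diag)
  have "?\<beta> ` ?\<nu> ` C = block_diags (closure1 n (nilp_orbit n l)) (closure1 n (nilp_orbit n m))
      \<longleftrightarrow> C = closure1 n (nilp_orbit n l) \<times> closure1 n (nilp_orbit n m)" for l m
  proof -
    let ?P = "closure1 n (nilp_orbit n l) \<times> closure1 n (nilp_orbit n m)"
    have PV: "?P \<subseteq> ?V" unfolding closure1_def by (intro Sigma_mono zariski_closure_subset)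
    have prod: "block_diags (closure1 n (nilp_orbit n l)) (closure1 n (nilp_orbit n m)) = ?\<beta> ` ?P"
      unfolding block_diags_def by auto
    have cancel: "?\<beta> ` ?\<nu> ` C = ?\<beta> ` ?P \<longleftrightarrow> ?\<nu> ` C = ?P"
      by (rule inj_on_image_eq_iff[OF inj]) (use CV \<nu>V PV in blast)+
    have invol: "?\<nu> ` ?\<nu> ` S = S" if "S \<subseteq> ?V" for S
    proof -
      have "?\<nu> ` ?\<nu> ` S = (\<lambda>v. v) ` S"
        unfolding image_image by (rule image_cong) (use \<nu>\<nu> that in auto)
      then show ?thesis by simp
    qed
    \<comment> \<open>The sign change preserves every product of nilpotent orbit closures.\<close>
    have le: "?\<nu> ` ?P \<subseteq> ?P" using closure_nilp_orbit_uminus by auto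
    have "?\<nu> ` ?P = ?P" using image_mono[OF le, of ?\<nu>] invol[OF PV] le by (intro subset_antisym) simp_all
    then have "?\<nu> ` C = ?P \<longleftrightarrow> C = ?P"
      using invol[OF CV] by (intro iffI) (drule arg_cong[of _ _ "image ?\<nu>"], simp, simp)
    then show ?thesis unfolding prod cancel .
  qed
  then show ?thesis
    unfolding Xi_k_def Phi_def Xi closure_saturation_conormal_comp[OF t] C_def[symmetric] by simp
qed

end
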